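(* The depinning force $F_d:\mathcal{R}\to\mathbb{R}$, defined on the space $\mathcal{R}$ of rotation symbols, is continuous.
   Context: Setting. $h:\mathbb{R}\times\mathbb{R}\to\mathbb{R}$ is $C^2$, satisfies $h(x+1,x'+1)=h(x,x')$, and has $h_{12}(x,x')\le -c<0$ for some constant $c>0$ (subscripts denote partial derivatives). For a tilt $F\ge 0$ the tilted Frenkel-Kontorova chain is $$\dot x_n=-h_2(x_{n-1},x_n)-h_1(x_n,x_{n+1})+F,\qquad n\in\mathbb{Z};$$ equilibria are sequences $\mathbf{x}=(x_n)\in\mathbb{R}^{\mathbb{Z}}$ with $h_2(x_{n-1},x_n)+h_1(x_n,x_{n+1})=F$ for all $n$. Order and translations. $\mathbf{x}\le\mathbf{y}$ means $x_n\le y_n$ for all $n$. $(T_{qp}\mathbf{x})_n=x_{n-q}+p$. A configuration is Birkhoff if $\{T_{qp}\mathbf{x}:p,q\in\mathbb{Z}\}$ is totally ordered by $\le$; it then has a mean spacing $\omega=\lim_{n\to\pm\infty}(x_n-x_0)/n$. It is of type $(p,q)$ if $T_{qp}\mathbf{x}=\mathbf{x}$. Rationals $p/q$ are in lowest terms with $q>0$. Depinning force on $\mathbb{R}$. For each $\omega\in\mathbb{R}$ it is known that there is a unique $F_d(\omega)\ge0$ such that for $0\le F\le F_d(\omega)$ there is a Birkhoff equilibrium of mean spacing $\omega$ (of type $(p,q)$ if $\omega=p/q$), and for $F>F_d(\omega)$ there is none. Rotation symbols. $\mathcal{R}$ is obtained from $\mathbb{R}$ by replacing each rational $p/q$ by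 three points $p/q-,\ p/q,\ p/q+$, with total order determined by $\omega_1<p/q-<p/q<p/q+<\omega_2$ for all reals $\omega_1<p/q<\omega_2$ (extending the usual order of the reals). The topology on $\mathcal{R}$ is that generated by the open intervals of this order. Extension to $\mathcal{R}$. At each irrational $\omega$ and at each symbol $p/q$ (with $\omega=p/q$), $F_d$ takes the value $F_d(\omega)$ of the depinning force on $\mathbb{R}$, i.e. the unique number such that a Birkhoff equilibrium of mean spacing $\omega$ (of type $(p,q)$ if $\omega=p/q$) exists for $0\le F\le F_d(\omega)$ and none exists for $F>F_d(\omega)$; and $F_d(p/q+)=\lim_{\omega\searrow p/q}F_d(\omega)$, $F_d(p/q-)=\lim_{\omega\nearrow p/q}F_d(\omega)$ (limits over real $\omega$; these limits exist). *)

theory Defs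
  imports "HOL-Analysis.Analysis"
begin

definition D1 :: "(real \<Rightarrow> real \<Rightarrow> real) \<Rightarrow> real \<Rightarrow> real \<Rightarrow> real" where
  "D1 f x y = deriv (\<lambda>s. f s y) x"

definition D2 :: "(real \<Rightarrow> real \<Rightarrow> real) \<Rightarrow> real \<Rightarrow> real \<Rightarrow> real" where
  "D2 f x y = deriv (\<lambda>s. f x s) y"

definition C1_fun :: "(real \<Rightarrow> real \<Rightarrow> real) \<Rightarrow> bool" where
  "C1_fun f \<longleftrightarrow>
     (\<forall>x y. (\<lambda>s. f s y) field_differentiable at x) \<and>
     (\<forall>x y. (\<lambda>s. f x s) field_differentiable at y) \<and>
     continuous_on UNIV (\<lambda>(x, y). D1 f x y) \<and>
     continuous_on UNIV (\<lambda>(x, y). D2 f x y)"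

definition C2_fun :: "(real \<Rightarrow> real \<Rightarrow> real) \<Rightarrow> bool" where
  "C2_fun f \<longleftrightarrow> C1_fun f \<and> C1_fun (D1 f) \<and> C1_fun (D2 f)"

type_synonym config = "int \<Rightarrow> real"

definition equilibrium :: "(real \<Rightarrow> real \<Rightarrow> real) \<Rightarrow> real \<Rightarrow> config \<Rightarrow> bool" where
  "equilibrium h F x \<longleftrightarrow>
     (\<forall>n. D2 h (x (n - 1)) (x n) + D1 h (x n) (x (n + 1)) = F)"

definition translate :: "int \<Rightarrow> int \<Rightarrow> config \<Rightarrow> config" where
  "translate q p x = (\<lambda>n. x (n - q) + of_int p)"

(* The relation \<le> on configurations is the pointwise order of the function type. *)
definition birkhoff :: "config \<Rightarrow> bool" where
  "birkhoff x \<longleftrightarrow>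
     (\<forall>q p q' p'. translate q p x \<le> translate q' p' x \<or>
                   translate q' p' x \<le> translate q p x)"

definition has_mean_spacing :: "config \<Rightarrow> real \<Rightarrow> bool" where
  "has_mean_spacing x \<omega> \<longleftrightarrow>
     ((\<lambda>n. (x n - x 0) / of_int n) \<longlongrightarrow> \<omega>) at_top \<and>
     ((\<lambda>n. (x n - x 0) / of_int n) \<longlongrightarrow> \<omega>) at_bot"

definition of_type :: "int \<Rightarrow> int \<Rightarrow> config \<Rightarrow> bool" where
  "of_type p q x \<longleftrightarrow> translate q p x = x"

(* For irrational \<omega> the last conjunct is vacuous; for rational \<omega> exactly one pair (p, q) satisfies
   its premises. *)
definition birkhoff_equilibrium ::
    "(real \<Rightarrow> real \<Rightarrow> real) \<Rightarrow> real \<Rightarrow> real \<Rightarrow> config \<Rightarrow> bool" where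
  "birkhoff_equilibrium h F \<omega> x \<longleftrightarrow>
     equilibrium h F x \<and> birkhoff x \<and> has_mean_spacing x \<omega> \<and>
     (\<forall>p q. q > 0 \<and> coprime p q \<and> \<omega> = of_int p / of_int q \<longrightarrow> of_type p q x)"

definition depinning_force :: "(real \<Rightarrow> real \<Rightarrow> real) \<Rightarrow> real \<Rightarrow> real" where
  "depinning_force h \<omega> =
     (THE D. D \<ge> 0 \<and>
        (\<forall>F. 0 \<le> F \<and> F \<le> D \<longrightarrow> (\<exists>x. birkhoff_equilibrium h F \<omega> x)) \<and>
        (\<forall>F. F > D \<longrightarrow> \<not> (\<exists>x. birkhoff_equilibrium h F \<omega> x)))"

(* Number \<omega> is the real number \<omega> itself, rational or not; Minus r and Plus r are the symbols
   r- and r+ adjacent to the rational r. *)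
datatype rotsym = Number real | Minus rat | Plus rat

primrec underlying :: "rotsym \<Rightarrow> real" where
  "underlying (Number \<omega>) = \<omega>"
| "underlying (Minus r) = of_rat r"
| "underlying (Plus r) = of_rat r"

primrec side :: "rotsym \<Rightarrow> int" where
  "side (Number \<omega>) = 0"
| "side (Minus r) = -1"
| "side (Plus r) = 1"

lemma rotsym_eqI: "underlying s = underlying t \<Longrightarrow> side s = side t \<Longrightarrow> s = t"
  by (cases s; cases t) auto

instantiation rotsym :: linorder
begin

definition less_rotsym :: "rotsym \<Rightarrow> rotsym \<Rightarrow> bool" where
  "s < t \<longleftrightarrow> underlying s < underlying t \<or> (underlying s = underlying t \<and> side s < side t)"

definition less_eq_rotsym :: "rotsym \<Rightarrow> rotsym \<Rightarrow> bool" where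
  "s \<le> t \<longleftrightarrow> s < t \<or> s = (t :: rotsym)"

instance
  by standard (auto simp: less_rotsym_def less_eq_rotsym_def intro: rotsym_eqI)

end

lemma rotsym_order:
  assumes "\<omega>\<^sub>1 < of_rat r" and "of_rat r < \<omega>\<^sub>2"
  shows "Number \<omega>\<^sub>1 < Minus r" "Minus r < Number (of_rat r)"
    "Number (of_rat r) < Plus r" "Plus r < Number \<omega>\<^sub>2"
  using assms by (auto simp: less_rotsym_def)

instance rotsym :: no_bot
proof
  fix s :: rotsym
  have "Number (underlying s - 1) < s"
    by (simp add: less_rotsym_def)
  then show "\<exists>t. t < s" ..
qed

instance rotsym :: no_top
proof
  fix s :: rotsym
  have "s < Number (underlying s + 1)"
    by (simp add: less_rotsym_def)
  then show "\<exists>t. s < t" ..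
qed

instantiation rotsym :: linorder_topology
begin

definition open_rotsym :: "rotsym set \<Rightarrow> bool" where
  "open_rotsym = generate_topology {{a<..<b} | a b. True}"

instance
proof
  let ?I = "{{a<..<b} | a b. True} :: rotsym set set"
  let ?R = "range lessThan \<union> range greaterThan :: rotsym set set"
  have lt: "generate_topology ?I {..<a}" for a
  proof -
    have "generate_topology ?I (\<Union>b. {b<..<a})"
      by (rule generate_topology.UN) (auto intro: generate_topology.Basis)
    also have "(\<Union>b. {b<..<a}) = {..<a}"
      using lt_ex by auto
    finally show ?thesis .
  qed
  have gt: "generate_topology ?I {a<..}" for a
  proof -
    have "generate_topology ?I (\<Union>b. {a<..<b})"
      by (rule generate_topology.UN) (auto intro: generate_topology.Basis)
    also have "(\<Union>b. {a<..<b}) = {a<..}"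
      using gt_ex by auto
    finally show ?thesis .
  qed
  have int: "generate_topology ?R {a<..<b}" for a b
    unfolding greaterThanLessThan_def
    by (intro generate_topology.Int generate_topology.Basis) auto
  have "generate_topology ?I S" if "generate_topology ?R S" for S
    using that
  proof induction
    case (Basis S)
    then show ?case using lt gt by blast
  qed (auto intro: generate_topology.intros)
  moreover have "generate_topology ?R S" if "generate_topology ?I S" for S
    using that
  proof induction
    case (Basis S)
    then show ?case using int by blast
  qed (auto intro: generate_topology.intros)
  ultimately show "(open :: rotsym set \<Rightarrow> bool) = generate_topology ?R"
    unfolding open_rotsym_def by blast
qed

end

primrec depinning_force_rot :: "(real \<Rightarrow> real \<Rightarrow> real) \<Rightarrow> rotsym \<Rightarrow> real" where
  "depinning_force_rot h (Number \<omega>) = depinning_force h \<omega>"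
| "depinning_force_rot h (Minus r) = Lim (at_left (of_rat r)) (depinning_force h)"
| "depinning_force_rot h (Plus r) = Lim (at_right (of_rat r)) (depinning_force h)"

end

theory Submission imports Defs
begin

text \<open>
The chain is cooperative: by the twist condition, the restoring force on a particle decreases
when its neighbours are raised. So sub- and supersolutions can be compared, and a Birkhoff equilibrium of
tilt F and mean spacing \<omega> exists as soon as there are a subsolution and a supersolution at bounded
distance from the line n * \<omega> (lemma birkhoff_equilibrium_between): an infimum of translates of the
supersolution is a Birkhoff supersolution, and Perron's method below it yields an equilibrium with
the same symmetries. At zero tilt equilibria are obtained by minimizing the periodic action and
passing to limits (admits_zero). They are subsolutions for all F \<ge> 0; thus, for such F, F \<le> F_d(\<omega>) if and only
if there is a supersolution of tilt F at bounded distance from n * \<omega>. Compactness of Birkhoff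
equilibria shows that F_d is well defined and upper semicontinuous on the reals.

The main point is a lower bound that is stable under changes of \<omega>. If F < F_d(\<omega>), the hull function
of a supersolution may be rounded down to a step function with finitely many jumps per period, still a
supersolution at tilt F. Whether a step function is a supersolution depends only on the relative
order of its jump points s i and of their translates by \<omega>, that is on the signs of
s i + k * \<omega> - s j with |k| \<le> 2. Up to periodicity, finitely many signs matter. This has two
consequences.

First, a prescribed pattern of signs is a convex condition on (s, \<omega>). Hence for F < F' the set of \<omega>
in a bounded interval with F' \<le> F_d(\<omega>) is covered by finitely many intervals on which F \<le> F_d
(for 0 \<le> F, admits_covered_by_intervals). So F_d does not oscillate, and all its one-sided limits exist.

Second, at an irrational \<omega> the jumps can be moved along with \<omega> so that coincidences
s i + k * \<omega> = s j + m persist (step_admissible_near_irrational). So F_d is lower semicontinuous,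
hence continuous, at irrational \<omega>.

In the topology of rotation symbols the point p/q is isolated, neighbourhoods of p/q+ and p/q- are
one-sided, and those of an irrational are two-sided; so these facts together are the continuity of
the extended F_d.
\<close>

section \<open>The twist condition and the force\<close>

locale fk_chain =
  fixes h :: "real \<Rightarrow> real \<Rightarrow> real" and c :: real
  assumes C2: "C2_fun h"
    and h_periodic: "\<And>x x'. h (x + 1) (x' + 1) = h x x'"
    and c_pos: "c > 0"
    and twist: "\<And>x x'. D2 (D1 h) x x' \<le> - c"
begin

lemma D1_has_derivative: "((\<lambda>s. h s y) has_real_derivative D1 h x y) (at x)"
  using C2 unfolding C2_fun_def C1_fun_def D1_def
  by (simp add: DERIV_deriv_iff_field_differentiable)

lemma D2_has_derivative: "((\<lambda>s. h x s) has_real_derivative D2 h x y) (at y)"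
  using C2 unfolding C2_fun_def C1_fun_def D2_def
  by (simp add: DERIV_deriv_iff_field_differentiable)

lemma continuous_D1: "continuous_on UNIV (\<lambda>(x, y). D1 h x y)"
  and continuous_D2: "continuous_on UNIV (\<lambda>(x, y). D2 h x y)"
  using C2 unfolding C2_fun_def C1_fun_def by auto

lemma D1_antimono_right:
  assumes "y \<le> y'"
  shows "D1 h x y' \<le> D1 h x y"
proof (rule DERIV_nonpos_imp_nonincreasing[OF assms])
  fix s
  have "(\<lambda>s. D1 h x s) field_differentiable at s"
    using C2 unfolding C2_fun_def C1_fun_def by blast
  then have "((\<lambda>s. D1 h x s) has_real_derivative D2 (D1 h) x s) (at s)"
    by (simp add: D2_def DERIV_deriv_iff_field_differentiable)
  moreover have "D2 (D1 h) x s \<le> 0"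
    using twist[of x s] c_pos by linarith
  ultimately show "\<exists>d. ((\<lambda>s. D1 h x s) has_real_derivative d) (at s) \<and> d \<le> 0"
    by blast
qed

text \<open>
The hypothesis bounds D2 (D1 h), and monotonicity of D2 h in its first argument concerns the other
mixed derivative. Their equality is avoided: by the twist, the increment h x y' - h x y is
decreasing in x, hence h x y - h x' y is increasing in y, and its derivative is nonnegative.
\<close>

lemma D2_antimono_left:
  assumes "x \<le> x'"
  shows "D2 h x' y \<le> D2 h x y"
proof -
  have step: "h x' y' - h x' y \<le> h x y' - h x y" if "y \<le> y'" for y y'
  proof (rule DERIV_nonpos_imp_nonincreasing[OF assms, of "\<lambda>s. h s y' - h s y"])
    fix s
    have "((\<lambda>s. h s y' - h s y) has_real_derivative D1 h s y' - D1 h s y) (at s)"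
      by (intro derivative_intros D1_has_derivative)
    then show "\<exists>d. ((\<lambda>s. h s y' - h s y) has_real_derivative d) (at s) \<and> d \<le> 0"
      using D1_antimono_right[OF that, of s] by auto
  qed
  have "mono_on UNIV (\<lambda>s. h x s - h x' s)"
    by (rule mono_onI) (use step in fastforce)
  moreover have "((\<lambda>s. h x s - h x' s) has_real_derivative D2 h x y - D2 h x' y) (at y)"
    by (intro derivative_intros D2_has_derivative)
  ultimately have "D2 h x y - D2 h x' y \<ge> 0"
    by (rule mono_on_imp_deriv_nonneg) simp
  then show ?thesis by simp
qed

lemma D1_periodic: "D1 h (x + 1) (y + 1) = D1 h x y"
proof -
  have "((\<lambda>s. h (s + 1) (y + 1)) has_real_derivative D1 h (x + 1) (y + 1)) (at x)"
    using D1_has_derivative[of "y + 1" "x + 1"] by (simp only: DERIV_shift)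
  then have "((\<lambda>s. h s y) has_real_derivative D1 h (x + 1) (y + 1)) (at x)"
    by (simp only: h_periodic)
  then show ?thesis using D1_has_derivative DERIV_unique by blast
qed

lemma D2_periodic: "D2 h (x + 1) (y + 1) = D2 h x y"
proof -
  have "((\<lambda>s. h (x + 1) (s + 1)) has_real_derivative D2 h (x + 1) (y + 1)) (at y)"
    using D2_has_derivative[of "x + 1" "y + 1"] by (simp only: DERIV_shift)
  then have "((\<lambda>s. h x s) has_real_derivative D2 h (x + 1) (y + 1)) (at y)"
    by (simp only: h_periodic)
  then show ?thesis using D2_has_derivative DERIV_unique by blast
qed

text \<open>
The restoring force on the middle one of three consecutive particles: the derivative of the energy
with respect to its position. The chain evolves with velocity F - force.
\<close>

definition force :: "real \<Rightarrow> real \<Rightarrow> real \<Rightarrow> real" where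
  "force a b d = D2 h a b + D1 h b d"

lemma equilibrium_iff: "equilibrium h F x \<longleftrightarrow> (\<forall>n. force (x (n - 1)) (x n) (x (n + 1)) = F)"
  unfolding equilibrium_def force_def ..

text \<open>
This is the cooperativity of the chain: raising the neighbours of a particle increases its velocity. All
comparison arguments below rest on it.
\<close>

lemma force_antimono: "a \<le> a' \<Longrightarrow> d \<le> d' \<Longrightarrow> force a' b d' \<le> force a b d"
  unfolding force_def by (intro add_mono D1_antimono_right D2_antimono_left)

lemma force_shift: "force (a + of_int m) (b + of_int m) (d + of_int m) = force a b d"
proof -
  have "D1 h (x + of_int m) (y + of_int m) = D1 h x y
      \<and> D2 h (x + of_int m) (y + of_int m) = D2 h x y" for x y
  proof (induction m rule: int_induct[where k = 0])
    case (step1 i)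
    then show ?case
      using D1_periodic[of "x + of_int i" "y + of_int i"] D2_periodic[of "x + of_int i" "y + of_int i"]
      by (simp add: add.assoc)
  next
    case (step2 i)
    then show ?case
      using D1_periodic[of "x + of_int (i - 1)" "y + of_int (i - 1)"]
        D2_periodic[of "x + of_int (i - 1)" "y + of_int (i - 1)"]
      by (simp add: add.assoc)
  qed simp
  then show ?thesis by (simp add: force_def)
qed

lemma continuous_force: "continuous_on UNIV (\<lambda>(a, b, d). force a b d)"
proof -
  have "continuous_on UNIV (\<lambda>p. case (fst p, fst (snd p)) of (x, y) \<Rightarrow> D2 h x y)"
    by (rule continuous_on_compose2[OF continuous_D2]) (auto intro!: continuous_intros)
  moreover have "continuous_on UNIV (\<lambda>p. case (fst (snd p), snd (snd p)) of (x, y) \<Rightarrow> D1 h x y)"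
    by (rule continuous_on_compose2[OF continuous_D1]) (auto intro!: continuous_intros)
  ultimately show ?thesis
    unfolding force_def case_prod_unfold by (auto intro!: continuous_intros)
qed

lemma tendsto_force:
  assumes "(f \<longlongrightarrow> a) net" "(g \<longlongrightarrow> b) net" "(k \<longlongrightarrow> d) net"
  shows "((\<lambda>t. force (f t) (g t) (k t)) \<longlongrightarrow> force a b d) net"
proof -
  have "isCont (\<lambda>(a, b, d). force a b d) (a, b, d)"
    using continuous_force by (simp add: continuous_on_eq_continuous_at)
  from isCont_tendsto_compose[OF this tendsto_Pair[OF assms(1) tendsto_Pair[OF assms(2,3)]]]
  show ?thesis by simp
qed

text \<open>
A modulus of continuity of the force that is uniform over all triples of spacing at most K. It
exists because the diagonal translations act cocompactly on the set of these triples.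
\<close>

definition force_modulus :: "real \<Rightarrow> real \<Rightarrow> real \<Rightarrow> bool" where
  "force_modulus K \<delta> e \<longleftrightarrow> \<delta> > 0 \<and>
     (\<forall>a b d a' b' d'. \<bar>a - b\<bar> \<le> K \<and> \<bar>d - b\<bar> \<le> K \<and>
        \<bar>a - a'\<bar> \<le> \<delta> \<and> \<bar>b - b'\<bar> \<le> \<delta> \<and> \<bar>d - d'\<bar> \<le> \<delta> \<longrightarrow>
        \<bar>force a b d - force a' b' d'\<bar> < e)"

lemma force_modulusD:
  assumes "force_modulus K \<delta> e" "\<bar>a - b\<bar> \<le> K" "\<bar>d - b\<bar> \<le> K"
    and "\<bar>a - a'\<bar> \<le> \<delta>" "\<bar>b - b'\<bar> \<le> \<delta>" "\<bar>d - d'\<bar> \<le> \<delta>"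
  shows "\<bar>force a b d - force a' b' d'\<bar> < e"
  using assms unfolding force_modulus_def by blast

lemma force_modulus_exists:
  assumes "e > 0"
  obtains \<delta> where "force_modulus K \<delta> e"
proof -
  define S where "S = {-K-1..K+2} \<times> {-1..2::real} \<times> {-K-1..K+2}"
  have "compact S" unfolding S_def by (intro compact_Times compact_Icc)
  then have "uniformly_continuous_on S (\<lambda>(a, b, d). force a b d)"
    by (intro compact_uniformly_continuous continuous_on_subset[OF continuous_force]) auto
  then obtain \<eta> where \<eta>: "\<eta> > 0"
    and close: "\<And>p p'. p \<in> S \<Longrightarrow> p' \<in> S \<Longrightarrow> dist p' p < \<eta>
      \<Longrightarrow> dist (case p' of (a, b, d) \<Rightarrow> force a b d) (case p of (a, b, d) \<Rightarrow> force a b d) < e"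
    using assms unfolding uniformly_continuous_on_def by metis
  define \<delta> where "\<delta> = min 1 (\<eta> / 4)"
  have \<delta>: "\<delta> > 0" "\<delta> \<le> 1" "3 * \<delta> < \<eta>" using \<eta> by (auto simp: \<delta>_def)
  show thesis
  proof (rule that[of \<delta>], unfold force_modulus_def, intro conjI allI impI)
    fix a b d a' b' d' :: real
    assume "\<bar>a - b\<bar> \<le> K \<and> \<bar>d - b\<bar> \<le> K \<and>
        \<bar>a - a'\<bar> \<le> \<delta> \<and> \<bar>b - b'\<bar> \<le> \<delta> \<and> \<bar>d - d'\<bar> \<le> \<delta>"
    then have *: "\<bar>a - b\<bar> \<le> K" "\<bar>d - b\<bar> \<le> K" "\<bar>a - a'\<bar> \<le> \<delta>" "\<bar>b - b'\<bar> \<le> \<delta>" "\<bar>d - d'\<bar> \<le> \<delta>" by auto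
    define m where "m = - \<lfloor>b\<rfloor>"
    let ?s = "\<lambda>x. x + of_int m :: real"
    have m: "0 \<le> ?s b" "?s b \<le> 1" unfolding m_def by linarith+
    have "(?s a, ?s b, ?s d) \<in> S" "(?s a', ?s b', ?s d') \<in> S"
      unfolding S_def using * m \<delta>(2) by auto
    moreover have "dist (?s a', ?s b', ?s d') (?s a, ?s b, ?s d) < \<eta>"
    proof -
      have "norm (a' - a, b' - b, d' - d) \<le> \<bar>a' - a\<bar> + (\<bar>b' - b\<bar> + \<bar>d' - d\<bar>)"
        using norm_Pair_le[of "a' - a" "(b' - b, d' - d)"] norm_Pair_le[of "b' - b" "d' - d"] by simp
      then show ?thesis using * \<delta> by (simp add: dist_norm abs_minus_commute)
    qed
    ultimately have "dist (force (?s a') (?s b') (?s d')) (force (?s a) (?s b) (?s d)) < e"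
      using close by fastforce
    then show "\<bar>force a b d - force a' b' d'\<bar> < e"
      by (simp add: force_shift dist_real_def abs_minus_commute)
  qed (fact \<delta>)
qed

lemma force_bounded:
  obtains C where "\<And>a b d. \<bar>a - b\<bar> \<le> K \<Longrightarrow> \<bar>d - b\<bar> \<le> K \<Longrightarrow> \<bar>force a b d\<bar> \<le> C"
proof -
  define S where "S = {-K-1..K+2} \<times> {-1..2::real} \<times> {-K-1..K+2}"
  have "compact S" unfolding S_def by (intro compact_Times compact_Icc)
  then have "bounded ((\<lambda>(a, b, d). force a b d) ` S)"
    by (intro compact_imp_bounded compact_continuous_image continuous_on_subset[OF continuous_force]) auto
  then obtain C where "\<forall>y\<in>(\<lambda>(a, b, d). force a b d) ` S. norm y \<le> C"
    unfolding bounded_iff by blast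
  then have C: "\<bar>force a b d\<bar> \<le> C" if "(a, b, d) \<in> S" for a b d
    using that by fastforce
  show thesis
  proof (rule that)
    fix a b d assume *: "\<bar>a - b\<bar> \<le> K" "\<bar>d - b\<bar> \<le> K"
    define m where "m = - \<lfloor>b\<rfloor>"
    let ?s = "\<lambda>x. x + of_int m :: real"
    have m: "0 \<le> ?s b" "?s b \<le> 1" unfolding m_def by linarith+
    have "(?s a, ?s b, ?s d) \<in> S"
      unfolding S_def using * m by auto
    from C[OF this] show "\<bar>force a b d\<bar> \<le> C" by (simp add: force_shift)
  qed
qed

end

section \<open>Monotone functions of degree one and mean spacing\<close>

definition degree_one :: "(real \<Rightarrow> real) \<Rightarrow> bool" where
  "degree_one \<phi> \<longleftrightarrow> mono \<phi> \<and> (\<forall>t. \<phi> (t + 1) = \<phi> t + 1)"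

lemma degree_one_shift:
  assumes "degree_one \<phi>"
  shows "\<phi> (t + of_int m) = \<phi> t + of_int m"
proof (induction m rule: int_induct[where k = 0])
  case (step1 i)
  have "\<phi> ((t + of_int i) + 1) = \<phi> (t + of_int i) + 1"
    using assms unfolding degree_one_def by blast
  with step1 show ?case by (simp add: add.assoc)
next
  case (step2 i)
  have "\<phi> ((t + of_int (i - 1)) + 1) = \<phi> (t + of_int (i - 1)) + 1"
    using assms unfolding degree_one_def by blast
  with step2 show ?case by (simp add: add.assoc)
qed simp

lemma degree_one_deviation:
  assumes "degree_one \<phi>"
  shows "\<bar>\<phi> t - \<phi> s - (t - s)\<bar> \<le> 1"
proof -
  define m where "m = \<lfloor>t - s\<rfloor>"
  have m: "s + of_int m \<le> t" "t \<le> s + of_int (m + 1)" unfolding m_def by linarith+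
  have "mono \<phi>" using assms by (simp add: degree_one_def)
  then have "\<phi> (s + of_int m) \<le> \<phi> t" "\<phi> t \<le> \<phi> (s + of_int (m + 1))"
    using m by (auto dest: monoD)
  then show ?thesis
    using m degree_one_shift[OF assms, of s m] degree_one_shift[OF assms, of s "m + 1"]
    unfolding of_int_add of_int_1 by linarith
qed

text \<open>
A metric substitute for the mean spacing, inherited by all configurations between two that have it,
and passing to pointwise limits once the bound is uniform. For Birkhoff configurations it is equivalent to having mean spacing \<omega>.
\<close>

definition bounded_deviation :: "real \<Rightarrow> config \<Rightarrow> bool" where
  "bounded_deviation \<omega> x \<longleftrightarrow> (\<exists>B. \<forall>n. \<bar>x n - of_int n * \<omega>\<bar> \<le> B)"

lemma bounded_deviation_shift:
  assumes "bounded_deviation \<omega> x"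
  shows "bounded_deviation \<omega> (\<lambda>n. x n + a)"
proof -
  obtain B where B: "\<And>n. \<bar>x n - of_int n * \<omega>\<bar> \<le> B"
    using assms unfolding bounded_deviation_def by blast
  have "\<bar>x n + a - of_int n * \<omega>\<bar> \<le> B + \<bar>a\<bar>" for n
    using B[of n] by linarith
  then show ?thesis unfolding bounded_deviation_def by blast
qed

lemma bounded_deviation_between:
  assumes "bounded_deviation \<omega> v" "bounded_deviation \<omega> u" "v \<le> x" "x \<le> u"
  shows "bounded_deviation \<omega> x"
proof -
  obtain B B' where B: "\<And>n. \<bar>v n - of_int n * \<omega>\<bar> \<le> B" "\<And>n. \<bar>u n - of_int n * \<omega>\<bar> \<le> B'"
    using assms unfolding bounded_deviation_def by blast
  have "\<bar>x n - of_int n * \<omega>\<bar> \<le> max B B'" for n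
    using B(1)[of n] B(2)[of n] le_funD[OF assms(3), of n] le_funD[OF assms(4), of n] by linarith
  then show ?thesis unfolding bounded_deviation_def by blast
qed

lemma bounded_deviation_le_shift:
  assumes "bounded_deviation \<omega> v" "bounded_deviation \<omega> u"
  obtains m :: int where "(\<lambda>n. v n + of_int m) \<le> u"
proof -
  obtain B B' where B: "\<And>n. \<bar>v n - of_int n * \<omega>\<bar> \<le> B" "\<And>n. \<bar>u n - of_int n * \<omega>\<bar> \<le> B'"
    using assms unfolding bounded_deviation_def by blast
  have "v n + of_int (- \<lceil>B + B'\<rceil>) \<le> u n" for n
    using B(1)[of n] B(2)[of n] le_of_int_ceiling[of "B + B'"]
    unfolding of_int_minus by linarith
  then show thesis by (intro that[of "- \<lceil>B + B'\<rceil>"] le_funI)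
qed

lemma bounded_deviation_imp_mean_spacing:
  assumes "bounded_deviation \<omega> x"
  shows "has_mean_spacing x \<omega>"
proof -
  obtain B where B: "\<And>n. \<bar>x n - of_int n * \<omega>\<bar> \<le> B"
    using assms unfolding bounded_deviation_def by blast
  have close: "dist ((x n - x 0) / of_int n) \<omega> < e" if "e > 0" "\<bar>n\<bar> > \<lceil>2 * B / e\<rceil>" "n \<noteq> 0" for e n
  proof -
    have n: "\<bar>of_int n :: real\<bar> > 0" using that by simp
    have "2 * B / e < \<bar>of_int n\<bar>" using that(2) by linarith
    then have "2 * B < e * \<bar>of_int n\<bar>" using that(1) by (simp add: field_simps)
    moreover have "\<bar>x n - x 0 - of_int n * \<omega>\<bar> \<le> 2 * B"
      using B[of n] B[of 0] by simp
    ultimately have "\<bar>x n - x 0 - of_int n * \<omega>\<bar> / \<bar>of_int n\<bar> < e"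
      using n by (simp add: divide_less_eq)
    moreover have "(x n - x 0) / of_int n - \<omega> = (x n - x 0 - of_int n * \<omega>) / of_int n"
      using that(3) by (simp add: field_simps)
    ultimately show ?thesis by (simp add: dist_real_def)
  qed
  show ?thesis
    unfolding has_mean_spacing_def
  proof (intro conjI tendstoI)
    fix e :: real assume e: "e > 0"
    have "\<forall>n \<ge> \<bar>\<lceil>2 * B / e\<rceil>\<bar> + 1. dist ((x n - x 0) / of_int n) \<omega> < e"
      using close[OF e] by auto
    then show "\<forall>\<^sub>F n in at_top. dist ((x n - x 0) / of_int n) \<omega> < e"
      unfolding eventually_at_top_linorder by blast
    have "\<forall>n \<le> - (\<bar>\<lceil>2 * B / e\<rceil>\<bar> + 1). dist ((x n - x 0) / of_int n) \<omega> < e"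
      using close[OF e] by auto
    then show "\<forall>\<^sub>F n in at_bot. dist ((x n - x 0) / of_int n) \<omega> < e"
      unfolding eventually_at_bot_linorder by blast
  qed
qed

context fk_chain
begin

section \<open>Sub- and supersolutions\<close>

definition supersolution :: "real \<Rightarrow> config \<Rightarrow> bool" where
  "supersolution F u \<longleftrightarrow> (\<forall>n. F \<le> force (u (n - 1)) (u n) (u (n + 1)))"

definition subsolution :: "real \<Rightarrow> config \<Rightarrow> bool" where
  "subsolution F u \<longleftrightarrow> (\<forall>n. force (u (n - 1)) (u n) (u (n + 1)) \<le> F)"

lemma equilibrium_iff_sub_super:
  "equilibrium h F x \<longleftrightarrow> subsolution F x \<and> supersolution F x"
  unfolding equilibrium_iff subsolution_def supersolution_def by (auto intro: order_antisym)

lemma subsolution_translate: "subsolution F x \<Longrightarrow> subsolution F (translate q p x)"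
proof -
  assume x: "subsolution F x"
  have "force (x (n - 1 - q)) (x (n - q)) (x (n + 1 - q)) \<le> F" for n
  proof -
    have "n - 1 - q = (n - q) - 1" "n + 1 - q = (n - q) + 1" by auto
    then show ?thesis using x unfolding subsolution_def by metis
  qed
  then show ?thesis
    by (simp add: subsolution_def translate_def force_shift)
qed

text \<open>
A hull function \<phi> parametrizes a Birkhoff configuration as x n = \<phi> (n * \<omega>). Here all its
translates x n = \<phi> (t + n * \<omega>) are required to be supersolutions at once.
\<close>

definition hull_supersolution :: "real \<Rightarrow> real \<Rightarrow> (real \<Rightarrow> real) \<Rightarrow> bool" where
  "hull_supersolution F \<omega> \<phi> \<longleftrightarrow> degree_one \<phi> \<and> (\<forall>t. F \<le> force (\<phi> (t - \<omega>)) (\<phi> t) (\<phi> (t + \<omega>)))"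

text \<open>
An infimum of supersolutions is a supersolution. Taking at each t the infimum of the translates of
u that start to the right of t gives a monotone family, so that the Birkhoff property comes for free
from mere boundedness of the deviation.
\<close>

lemma hull_supersolution_exists:
  assumes "supersolution F u" "bounded_deviation \<omega> u"
  obtains \<phi> where "hull_supersolution F \<omega> \<phi>"
proof -
  obtain B where B: "\<And>n. \<bar>u n - of_int n * \<omega>\<bar> \<le> B"
    using assms(2) unfolding bounded_deviation_def by blast
  define A where "A t = {u n + of_int m | n m. t < of_int n * \<omega> + of_int m}" for t
  define \<phi> where "\<phi> t = Inf (A t)" for t
  have ne: "A t \<noteq> {}" for t
  proof -
    have "t < of_int 0 * \<omega> + of_int (\<lfloor>t\<rfloor> + 1)" by simp
    then show ?thesis unfolding A_def by blast
  qed
  have bdd: "bdd_below (A t)" for t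
  proof (rule bdd_belowI)
    fix a assume "a \<in> A t"
    then obtain n m where "a = u n + of_int m" "t < of_int n * \<omega> + of_int m"
      unfolding A_def by blast
    then show "t - B \<le> a" using B[of n] by linarith
  qed
  have le: "\<phi> t \<le> u n + of_int m" if "t < of_int n * \<omega> + of_int m" for t n m
    unfolding \<phi>_def by (rule cInf_lower[OF _ bdd]) (use that in \<open>auto simp: A_def\<close>)
  have approx: "\<exists>n m. t < of_int n * \<omega> + of_int m \<and> u n + of_int m < \<phi> t + \<delta>" if "\<delta> > 0" for t \<delta>
  proof -
    have "Inf (A t) < \<phi> t + \<delta>" using that by (simp add: \<phi>_def)
    then obtain a where "a \<in> A t" "a < \<phi> t + \<delta>" using cInf_lessD[OF ne] by blast
    then show ?thesis unfolding A_def by blast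
  qed
  have mono: "mono \<phi>"
  proof (rule monoI)
    fix x y :: real assume "x \<le> y"
    then have "A y \<subseteq> A x" unfolding A_def by (blast intro: order_le_less_trans)
    then show "\<phi> x \<le> \<phi> y" unfolding \<phi>_def by (intro cInf_superset_mono ne bdd)
  qed
  have shift_le: "\<phi> (t + of_int k) \<le> \<phi> t + of_int k" for t k
  proof (rule field_le_epsilon)
    fix e :: real assume "e > 0"
    then obtain n m where nm: "t < of_int n * \<omega> + of_int m" "u n + of_int m < \<phi> t + e"
      using approx by blast
    then have "\<phi> (t + of_int k) \<le> u n + of_int (m + k)" by (intro le) simp
    with nm show "\<phi> (t + of_int k) \<le> \<phi> t + of_int k + e" by simp
  qed
  have "\<phi> (t + 1) = \<phi> t + 1" for t
    using shift_le[of t 1] shift_le[of "t + 1" "-1"] by simp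
  with mono have deg: "degree_one \<phi>" by (simp add: degree_one_def)
  have "F \<le> force (\<phi> (t - \<omega>)) (\<phi> t) (\<phi> (t + \<omega>))" for t
  proof (rule field_le_epsilon)
    fix e :: real assume "e > 0"
    obtain \<delta> where mod: "force_modulus (2 * B + \<bar>\<omega>\<bar>) \<delta> e"
      using force_modulus_exists[OF \<open>e > 0\<close>] .
    then have \<delta>: "\<delta> > 0" by (simp add: force_modulus_def)
    obtain n m where nm: "t < of_int n * \<omega> + of_int m" "u n + of_int m < \<phi> t + \<delta>"
      using approx[OF \<delta>] by blast
    let ?s = "\<lambda>x. x + of_int m :: real"
    have "\<phi> (t - \<omega>) \<le> ?s (u (n - 1))" "\<phi> (t + \<omega>) \<le> ?s (u (n + 1))"
      using nm(1) by (intro le; simp add: algebra_simps)+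
    then have "force (?s (u (n - 1))) (\<phi> t) (?s (u (n + 1))) \<le> force (\<phi> (t - \<omega>)) (\<phi> t) (\<phi> (t + \<omega>))"
      by (rule force_antimono)
    moreover have "\<bar>u (n - 1) - u n\<bar> \<le> 2 * B + \<bar>\<omega>\<bar>" "\<bar>u (n + 1) - u n\<bar> \<le> 2 * B + \<bar>\<omega>\<bar>"
      using B[of "n - 1"] B[of n] B[of "n + 1"] by (auto simp: algebra_simps abs_le_iff)
    then have "\<bar>force (?s (u (n - 1))) (?s (u n)) (?s (u (n + 1)))
        - force (?s (u (n - 1))) (\<phi> t) (?s (u (n + 1)))\<bar> < e"
      using nm le[OF nm(1)] \<delta> by (intro force_modulusD[OF mod]) auto
    moreover have "F \<le> force (?s (u (n - 1))) (?s (u n)) (?s (u (n + 1)))"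
      using assms(1) unfolding force_shift supersolution_def by blast
    ultimately show "F \<le> force (\<phi> (t - \<omega>)) (\<phi> t) (\<phi> (t + \<omega>)) + e" by linarith
  qed
  with deg show thesis by (intro that[of \<phi>]) (simp add: hull_supersolution_def)
qed

text \<open>
Perron's method. The supremum z of all subsolutions between v and u is a subsolution. If the
inequality were strict at some site, z would be strictly below the supersolution u there, and could
be raised slightly: this keeps the inequality at the site by continuity, and at its neighbours by
cooperativity. As the largest of all subsolutions below u, the solution z depends on u alone.
\<close>

lemma perron:
  assumes super: "supersolution F u" and sub: "subsolution F v" and vu: "v \<le> u"
  obtains z where "equilibrium h F z" "v \<le> z" "z \<le> u"
    "\<And>\<psi>. subsolution F \<psi> \<Longrightarrow> \<psi> \<le> u \<Longrightarrow> \<psi> \<le> z"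
proof -
  define C where "C = {\<psi>. subsolution F \<psi> \<and> v \<le> \<psi> \<and> \<psi> \<le> u}"
  define z where "z n = (SUP \<psi>\<in>C. \<psi> n)" for n
  have vC: "v \<in> C" using sub vu by (simp add: C_def)
  have bdd: "bdd_above ((\<lambda>\<psi>. \<psi> n) ` C)" for n
    by (rule bdd_aboveI[of _ "u n"]) (auto simp: C_def le_fun_def)
  have upper: "\<psi> \<le> z" if "\<psi> \<in> C" for \<psi>
    unfolding z_def by (intro le_funI cSUP_upper that bdd)
  have zu: "z \<le> u"
    unfolding z_def by (intro le_funI cSUP_least) (use vC in \<open>auto simp: C_def le_fun_def\<close>)
  have vz: "v \<le> z" by (rule upper[OF vC])
  have maximal: "\<psi> \<le> z" if "subsolution F \<psi>" "\<psi> \<le> u" for \<psi>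
  proof -
    \<comment> \<open>a maximum of two subsolutions is a subsolution\<close>
    let ?m = "\<lambda>n. max (\<psi> n) (v n)"
    have "force (?m (n - 1)) (?m n) (?m (n + 1)) \<le> F" for n
    proof (cases "v n \<le> \<psi> n")
      case True
      then have "force (?m (n - 1)) (?m n) (?m (n + 1)) \<le> force (\<psi> (n - 1)) (\<psi> n) (\<psi> (n + 1))"
        by (simp add: force_antimono)
      also have "\<dots> \<le> F" using that(1) by (simp add: subsolution_def)
      finally show ?thesis .
    next
      case False
      then have "force (?m (n - 1)) (?m n) (?m (n + 1)) \<le> force (v (n - 1)) (v n) (v (n + 1))"
        by (simp add: force_antimono)
      also have "\<dots> \<le> F" using sub by (simp add: subsolution_def)
      finally show ?thesis .
    qed
    then have "subsolution F ?m" unfolding subsolution_def by blast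
    moreover have "v \<le> ?m" "\<psi> \<le> ?m" by (auto intro: le_funI)
    moreover have "?m \<le> u"
      using that(2) vu by (intro le_funI max.boundedI) (auto dest: le_funD)
    ultimately have "?m \<in> C" by (simp add: C_def)
    from order_trans[OF \<open>\<psi> \<le> ?m\<close> upper[OF this]] show ?thesis .
  qed
  have z_sub: "subsolution F z"
    unfolding subsolution_def
  proof (rule allI, rule field_le_epsilon)
    fix n :: int and e :: real assume "e > 0"
    define K where "K = \<bar>u (n - 1) - v n\<bar> + \<bar>u n - v (n - 1)\<bar> + \<bar>u (n + 1) - v n\<bar> + \<bar>u n - v (n + 1)\<bar>"
    obtain \<delta> where mod: "force_modulus K \<delta> e"
      using force_modulus_exists[OF \<open>e > 0\<close>] .
    then have \<delta>: "\<delta> > 0" by (simp add: force_modulus_def)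
    have "z n - \<delta> < (SUP \<psi>\<in>C. \<psi> n)" using \<delta> by (simp add: z_def)
    then obtain \<psi> where \<psi>: "\<psi> \<in> C" "z n - \<delta> < \<psi> n"
      using less_cSUP_iff[OF _ bdd] vC by blast
    have \<psi>z: "\<psi> k \<le> z k" for k using upper[OF \<psi>(1)] by (simp add: le_fun_def)
    have b: "v k \<le> \<psi> k" "\<psi> k \<le> u k" "z k \<le> u k" for k
      using \<psi>(1) zu by (auto simp: C_def le_fun_def)
    have "force (z (n - 1)) (z n) (z (n + 1)) \<le> force (\<psi> (n - 1)) (z n) (\<psi> (n + 1))"
      by (intro force_antimono \<psi>z)
    moreover have "\<bar>force (\<psi> (n - 1)) (z n) (\<psi> (n + 1)) - force (\<psi> (n - 1)) (\<psi> n) (\<psi> (n + 1))\<bar> < e"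
    proof (rule force_modulusD[OF mod])
      show "\<bar>\<psi> (n - 1) - z n\<bar> \<le> K" "\<bar>\<psi> (n + 1) - z n\<bar> \<le> K"
        using b[of "n - 1"] b[of n] b[of "n + 1"] \<psi>z[of n] unfolding K_def by linarith+
    qed (use \<delta> \<psi> \<psi>z[of n] in auto)
    moreover have "force (\<psi> (n - 1)) (\<psi> n) (\<psi> (n + 1)) \<le> F"
      using \<psi>(1) by (simp add: C_def subsolution_def)
    ultimately show "force (z (n - 1)) (z n) (z (n + 1)) \<le> F + e" by linarith
  qed
  have z_super: "supersolution F z"
    unfolding supersolution_def
  proof (rule ccontr)
    assume "\<not> (\<forall>n. F \<le> force (z (n - 1)) (z n) (z (n + 1)))"
    then obtain n where n: "force (z (n - 1)) (z n) (z (n + 1)) < F"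
      by (auto simp: not_le)
    have "z n \<noteq> u n"
    proof
      assume "z n = u n"
      then have "force (u (n - 1)) (u n) (u (n + 1)) \<le> force (z (n - 1)) (z n) (z (n + 1))"
        using zu by (simp add: force_antimono le_fun_def)
      moreover have "F \<le> force (u (n - 1)) (u n) (u (n + 1))"
        using super by (simp add: supersolution_def)
      ultimately show False using n by linarith
    qed
    then have "z n < u n" using zu by (simp add: le_fun_def order_less_le)
    then have "\<forall>\<^sub>F r in at_right (z n). r < u n"
      by (auto simp: eventually_at_right_field)
    moreover have "((\<lambda>r. force (z (n - 1)) r (z (n + 1))) \<longlongrightarrow> force (z (n - 1)) (z n) (z (n + 1)))
        (at_right (z n))"
      by (intro tendsto_force tendsto_const tendsto_ident_at)
    from order_tendstoD(2)[OF this n]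
    have "\<forall>\<^sub>F r in at_right (z n). force (z (n - 1)) r (z (n + 1)) < F" .
    moreover have "\<forall>\<^sub>F r in at_right (z n). z n < r" by (rule eventually_at_right_less)
    ultimately have "\<forall>\<^sub>F r in at_right (z n). r < u n \<and> force (z (n - 1)) r (z (n + 1)) < F \<and> z n < r"
      by eventually_elim blast
    then obtain r where r: "r < u n" "force (z (n - 1)) r (z (n + 1)) < F" "z n < r"
      using eventually_happens'[OF trivial_limit_at_right_real] by blast
    let ?z = "z(n := r)"
    have zz: "z k \<le> ?z k" for k using r by simp
    have "force (?z (k - 1)) (?z k) (?z (k + 1)) \<le> F" for k
    proof (cases "k = n")
      case True
      then show ?thesis using r by simp
    next
      case False
      then have "force (?z (k - 1)) (?z k) (?z (k + 1)) \<le> force (z (k - 1)) (z k) (z (k + 1))"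
        using force_antimono[OF zz[of "k - 1"] zz[of "k + 1"]] by simp
      also have "\<dots> \<le> F" using z_sub by (simp add: subsolution_def)
      finally show ?thesis .
    qed
    then have "?z \<le> z"
      using r zu by (intro maximal) (auto simp: subsolution_def le_fun_def)
    then show False using r by (auto simp: le_fun_def dest: spec[of _ n])
  qed
  show thesis
    using that[of z] z_sub z_super vz zu maximal by (simp add: equilibrium_iff_sub_super)
qed

text \<open>
The solution of Perron's method inherits the symmetries of u: a translate of z lying below a
translate of u lies below the corresponding translate of z, because z is the largest
subsolution below u.
\<close>

lemma perron_birkhoff:
  assumes "supersolution F u" "subsolution F v" "v \<le> u" "birkhoff u"
  obtains z where "equilibrium h F z" "birkhoff z" "v \<le> z" "z \<le> u"
    "\<And>p q. of_type p q u \<Longrightarrow> of_type p q z"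
proof -
  from perron[OF assms(1-3)] obtain z where z: "equilibrium h F z" "v \<le> z" "z \<le> u"
    and maximal: "\<And>\<psi>. subsolution F \<psi> \<Longrightarrow> \<psi> \<le> u \<Longrightarrow> \<psi> \<le> z" by blast
  have order: "translate q p z \<le> translate q' p' z"
    if "translate q p u \<le> translate q' p' u" for q p q' p'
  proof -
    have "translate (q - q') (p - p') z \<le> u"
    proof (rule le_funI)
      fix n
      have "translate q p u (n + q') \<le> translate q' p' u (n + q')"
        using that by (rule le_funD)
      moreover have "z (n + q' - q) \<le> u (n + q' - q)" using z(3) by (rule le_funD)
      ultimately show "translate (q - q') (p - p') z n \<le> u n"
        by (simp add: translate_def algebra_simps)
    qed
    then have *: "translate (q - q') (p - p') z \<le> z"
      using z(1) by (intro maximal subsolution_translate) (simp_all add: equilibrium_iff_sub_super)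
    show ?thesis
    proof (rule le_funI)
      fix n show "translate q p z n \<le> translate q' p' z n"
        using le_funD[OF *, of "n - q'"] by (simp add: translate_def algebra_simps)
    qed
  qed
  have "birkhoff z"
    using assms(4) order unfolding birkhoff_def by blast
  moreover have "of_type p q z" if "of_type p q u" for p q
  proof -
    have id: "translate 0 0 x = x" for x :: config by (simp add: translate_def)
    show ?thesis
      using that order[of q p 0 0] order[of 0 0 q p] unfolding of_type_def id by auto
  qed
  ultimately show thesis using that z by blast
qed

text \<open>
Existence of a Birkhoff equilibrium is thus reduced to a sub- and a supersolution of bounded
deviation; an integer shift of the subsolution brings them into order.
\<close>

lemma birkhoff_equilibrium_between:
  assumes u: "supersolution F u" "bounded_deviation \<omega> u"
    and v: "subsolution F v" "bounded_deviation \<omega> v"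
  shows "\<exists>x. birkhoff_equilibrium h F \<omega> x"
proof -
  obtain \<phi> where \<phi>: "hull_supersolution F \<omega> \<phi>" using hull_supersolution_exists[OF u] .
  then have deg: "degree_one \<phi>" by (simp add: hull_supersolution_def)
  then have "mono \<phi>" by (simp add: degree_one_def)
  define w where "w n = \<phi> (of_int n * \<omega>)" for n
  have w_translate: "translate q p w n = \<phi> (of_int n * \<omega> + (of_int p - of_int q * \<omega>))" for q p n
    using degree_one_shift[OF deg, of "of_int (n - q) * \<omega>" p]
    by (simp add: translate_def w_def algebra_simps)
  have w_super: "supersolution F w"
    unfolding supersolution_def
  proof
    fix n
    have "F \<le> force (\<phi> (of_int n * \<omega> - \<omega>)) (\<phi> (of_int n * \<omega>)) (\<phi> (of_int n * \<omega> + \<omega>))"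
      using \<phi> unfolding hull_supersolution_def by blast
    then show "F \<le> force (w (n - 1)) (w n) (w (n + 1))"
      by (simp add: w_def algebra_simps)
  qed
  have w_birkhoff: "birkhoff w"
    unfolding birkhoff_def
  proof (intro allI)
    fix q p q' p' :: int
    show "translate q p w \<le> translate q' p' w \<or> translate q' p' w \<le> translate q p w"
    proof (cases "of_int p - of_int q * \<omega> \<le> of_int p' - of_int q' * \<omega>")
      case True
      then have "translate q p w \<le> translate q' p' w"
        unfolding le_fun_def w_translate by (intro allI monoD[OF \<open>mono \<phi>\<close>]) simp
      then show ?thesis ..
    next
      case False
      then have "translate q' p' w \<le> translate q p w"
        unfolding le_fun_def w_translate by (intro allI monoD[OF \<open>mono \<phi>\<close>]) simp
      then show ?thesis ..
    qed
  qed
  have w_type: "of_type p q w" if "q > 0" "\<omega> = of_int p / of_int q" for p q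
    using that unfolding of_type_def by (intro ext) (simp add: w_translate w_def)
  have "\<bar>w n - of_int n * \<omega>\<bar> \<le> 1 + \<bar>\<phi> 0\<bar>" for n
    using degree_one_deviation[OF deg, of "of_int n * \<omega>" 0] by (simp add: w_def)
  then have w_dev: "bounded_deviation \<omega> w" unfolding bounded_deviation_def by blast
  obtain m where m: "(\<lambda>n. v n + of_int m) \<le> w"
    using bounded_deviation_le_shift[OF v(2) w_dev] .
  have "subsolution F (\<lambda>n. v n + of_int m)"
    using subsolution_translate[OF v(1), of 0 m] by (simp add: translate_def)
  from perron_birkhoff[OF w_super this m w_birkhoff] obtain z where
    z: "equilibrium h F z" "birkhoff z" "(\<lambda>n. v n + of_int m) \<le> z" "z \<le> w"
      "\<And>p q. of_type p q w \<Longrightarrow> of_type p q z" by blast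
  have "has_mean_spacing z \<omega>"
    using bounded_deviation_between[OF bounded_deviation_shift[OF v(2)] w_dev z(3,4)]
    by (rule bounded_deviation_imp_mean_spacing)
  then have "birkhoff_equilibrium h F \<omega> z"
    using z w_type unfolding birkhoff_equilibrium_def by blast
  then show ?thesis by blast
qed

end

section \<open>Deviation of Birkhoff configurations from their mean spacing\<close>

text \<open>
If a particle advances by more than p over q sites, then by the Birkhoff property every particle
advances by at least p over q sites, which can be iterated to compare with the mean spacing.
\<close>

lemma birkhoff_mean_spacing_bounds:
  assumes x: "birkhoff x" "has_mean_spacing x \<omega>" and q: "q > 0"
  shows "x k + of_int p < x (k + q) \<Longrightarrow> of_int p \<le> of_int q * \<omega>"
    and "x (k + q) < x k + of_int p \<Longrightarrow> of_int q * \<omega> \<le> of_int p"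
proof -
  have "filterlim (\<lambda>j::nat. int j * q) at_top sequentially"
    unfolding filterlim_at_top
  proof
    fix Z :: int
    show "\<forall>\<^sub>F j::nat in sequentially. Z \<le> int j * q"
      using eventually_ge_at_top[of "nat Z"]
    proof eventually_elim
      case (elim j)
      have "int j * 1 \<le> int j * q" using q by (intro mult_left_mono) auto
      with elim show ?case by linarith
    qed
  qed
  moreover have "((\<lambda>n. (x n - x 0) / of_int n) \<longlongrightarrow> \<omega>) at_top"
    using x(2) by (simp add: has_mean_spacing_def)
  ultimately have lim: "(\<lambda>j::nat. (x (int j * q) - x 0) / of_int (int j * q)) \<longlonglongrightarrow> \<omega>"
    by (rule filterlim_compose[rotated])
  have order: "translate 0 p x \<le> translate (- q) 0 x \<or> translate (- q) 0 x \<le> translate 0 p x"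
    using x(1) unfolding birkhoff_def by blast
  {
    assume "x k + of_int p < x (k + q)"
    then have "\<not> translate (- q) 0 x \<le> translate 0 p x"
      by (auto simp: translate_def le_fun_def not_le)
    then have "translate 0 p x \<le> translate (- q) 0 x" using order by blast
    then have step: "x n + of_int p \<le> x (n + q)" for n
      by (auto simp: translate_def le_fun_def)
    have "x 0 + of_int j * of_int p \<le> x (int j * q)" for j :: nat
    proof (induction j)
      case (Suc j)
      then show ?case using step[of "int j * q"] by (simp add: algebra_simps)
    qed simp
    then have "of_int p / of_int q \<le> (x (int j * q) - x 0) / of_int (int j * q)" if "j > 0" for j :: nat
      using that q by (simp add: field_simps)
    then have "of_int p / of_int q \<le> \<omega>"
      by (intro LIMSEQ_le_const[OF lim] exI[of _ 1]) auto
    then show "of_int p \<le> of_int q * \<omega>" using q by (simp add: field_simps)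
  next
    assume "x (k + q) < x k + of_int p"
    then have "\<not> translate 0 p x \<le> translate (- q) 0 x"
      by (auto simp: translate_def le_fun_def not_le)
    then have "translate (- q) 0 x \<le> translate 0 p x" using order by blast
    then have step: "x (n + q) \<le> x n + of_int p" for n
      by (auto simp: translate_def le_fun_def)
    have "x (int j * q) \<le> x 0 + of_int j * of_int p" for j :: nat
    proof (induction j)
      case (Suc j)
      then show ?case using step[of "int j * q"] by (simp add: algebra_simps)
    qed simp
    then have upper: "x (int j * q) - x 0 \<le> of_int j * of_int p" for j :: nat
      by (simp add: algebra_simps)
    have "(x (int j * q) - x 0) / of_int (int j * q) \<le> of_int p / of_int q" if "j > 0" for j :: nat
      using divide_right_mono[OF upper[of j], of "of_int (int j * q)"] that q by simp
    then have "\<omega> \<le> of_int p / of_int q"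
      by (intro LIMSEQ_le_const2[OF lim] exI[of _ 1]) auto
    then show "of_int q * \<omega> \<le> of_int p" using q by (simp add: field_simps)
  }
qed

lemma birkhoff_deviation:
  assumes x: "birkhoff x" "has_mean_spacing x \<omega>"
  shows "\<bar>x n - x m - of_int (n - m) * \<omega>\<bar> \<le> 1"
proof -
  have pos: "\<bar>x (k + q) - x k - of_int q * \<omega>\<bar> \<le> 1" if q: "q > 0" for k q
  proof -
    \<comment> \<open>the greatest integer strictly below d and the least one strictly above it give the bounds\<close>
    define d where "d = x (k + q) - x k"
    have "x k + of_int (\<lceil>d\<rceil> - 1) < x (k + q)" unfolding d_def by linarith
    from birkhoff_mean_spacing_bounds(1)[OF x q this]
    have "d - 1 \<le> of_int q * \<omega>" by linarith
    moreover have "x (k + q) < x k + of_int (\<lfloor>d\<rfloor> + 1)" unfolding d_def by linarith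
    from birkhoff_mean_spacing_bounds(2)[OF x q this]
    have "of_int q * \<omega> \<le> d + 1" by linarith
    ultimately show ?thesis unfolding d_def by linarith
  qed
  consider "n > m" | "n = m" | "n < m" by linarith
  then show ?thesis
  proof cases
    case 1
    then show ?thesis using pos[of "n - m" m] by simp
  next
    case 3
    then show ?thesis using pos[of "m - n" n] by (simp add: algebra_simps abs_le_iff)
  qed simp
qed

section \<open>Staircases\<close>

lemma mono_intI:
  fixes y :: "int \<Rightarrow> real"
  assumes "\<And>j. y j \<le> y (j + 1)"
  shows "mono y"
proof (rule monoI)
  fix i j :: int
  assume "i \<le> j"
  then show "y i \<le> y j"
    by (induction rule: int_ge_induct) (use assms in \<open>auto intro: order_trans\<close>)
qed

text \<open>
A discrete counterpart of degree one functions, with period q instead of 1. Staircases occur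
twice: y j is the value at j / q of the hull function of a periodic configuration, or s j is the
place at which a step function of step height 1 / q reaches the level j / q.
\<close>

definition staircase :: "int \<Rightarrow> (int \<Rightarrow> real) \<Rightarrow> bool" where
  "staircase q y \<longleftrightarrow> mono y \<and> (\<forall>j. y (j + q) = y j + 1)"

lemma periodic_int_shift:
  fixes g :: "int \<Rightarrow> 'a::ring_1"
  assumes "\<And>j. g (j + q) = g j + a"
  shows "g (j + m * q) = g j + of_int m * a"
proof (induction m rule: int_induct[where k = 0])
  case (step1 i)
  then show ?case using assms[of "j + i * q"] by (simp add: algebra_simps)
next
  case (step2 i)
  then show ?case using assms[of "j + (i - 1) * q"] by (simp add: algebra_simps)
qed simp

lemma staircase_shift:
  assumes "staircase q y"
  shows "y (j + m * q) = y j + of_int m"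
  using periodic_int_shift[of y q 1 j m] assms by (simp add: staircase_def)

lemma staircaseI:
  assumes shift: "\<And>j. y (j + q) = y j + 1" and step: "\<And>j. j \<in> {0..<q} \<Longrightarrow> y j \<le> y (j + 1)" and q: "q > 0"
  shows "staircase q y"
proof -
  have "y j \<le> y (j + 1)" for j
  proof -
    have "y (j mod q) \<le> y (j mod q + 1)" using q by (intro step) simp
    moreover have "y (j mod q + (j div q) * q) = y (j mod q) + of_int (j div q)"
      "y (j mod q + 1 + (j div q) * q) = y (j mod q + 1) + of_int (j div q)"
      using periodic_int_shift[of y q 1, OF shift, of "j mod q" "j div q"]
        periodic_int_shift[of y q 1, OF shift, of "j mod q + 1" "j div q"]
      unfolding mult_1_right by blast+
    moreover have "j mod q + (j div q) * q = j" "j mod q + 1 + (j div q) * q = j + 1"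
      by (simp_all add: add.commute)
    ultimately show ?thesis by simp
  qed
  then show ?thesis using shift by (simp add: staircase_def mono_intI)
qed

lemma staircase_deviation:
  assumes y: "staircase q y" and q: "q > 0"
  shows "\<bar>y j - y i - of_int (j - i) / of_int q\<bar> \<le> 1"
proof -
  define m where "m = (j - i) div q"
  have m: "i + m * q \<le> j" "j \<le> i + (m + 1) * q"
    using div_mult_mod_eq[of "j - i" q] pos_mod_bound[OF q, of "j - i"]
      pos_mod_sign[OF q, of "j - i"]
    unfolding m_def distrib_right mult_1 by linarith+
  have "mono y" using y by (simp add: staircase_def)
  then have "y (i + m * q) \<le> y j" "y j \<le> y (i + (m + 1) * q)"
    using m by (auto dest: monoD)
  then have "y i + of_int m \<le> y j" "y j \<le> y i + of_int m + 1"
    unfolding staircase_shift[OF y] by simp_all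
  moreover have "of_int m \<le> of_int (j - i) / (of_int q :: real)"
    "of_int (j - i) / (of_int q :: real) \<le> of_int m + 1"
  proof -
    have "of_int (m * q) \<le> (of_int (j - i) :: real)" "of_int (j - i) \<le> (of_int ((m + 1) * q) :: real)"
      using m by linarith+
    then show "of_int m \<le> of_int (j - i) / (of_int q :: real)"
      "of_int (j - i) / (of_int q :: real) \<le> of_int m + 1"
      using q by (simp_all add: field_simps)
  qed
  ultimately show ?thesis by linarith
qed

lemma sum_periodic_shift:
  fixes g :: "int \<Rightarrow> real"
  assumes per: "\<And>j. g (j + q) = g j" and q: "q > 0"
  shows "(\<Sum>j\<in>{0..<q}. g (j + p)) = (\<Sum>j\<in>{0..<q}. g j)"
proof -
  have step: "(\<Sum>j\<in>{a + 1..<a + 1 + q}. g j) = (\<Sum>j\<in>{a..<a + q}. g j)" for a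
  proof -
    have "{a + 1..<a + 1 + q} = insert (a + q) {a + 1..<a + q}"
      and "{a..<a + q} = insert a {a + 1..<a + q}" using q by auto
    then show ?thesis by (simp add: per)
  qed
  have "(\<Sum>j\<in>{p..<p + q}. g j) = (\<Sum>j\<in>{0..<q}. g j)"
  proof (induction p rule: int_induct[where k = 0])
    case (step1 i)
    then show ?case using step[of i] by simp
  next
    case (step2 i)
    then show ?case using step[of "i - 1"] by simp
  qed simp
  moreover have "(\<Sum>j\<in>{0..<q}. g (j + p)) = (\<Sum>j\<in>{p..<p + q}. g j)"
    by (rule sum.reindex_bij_witness[of _ "\<lambda>j. j - p" "\<lambda>j. j + p"]) auto
  ultimately show ?thesis by simp
qed

section \<open>Compactness of Birkhoff equilibria\<close>

lemma compact_int_box: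
  fixes a b :: "int \<Rightarrow> real"
  shows "compact {y. \<forall>j. a j \<le> y j \<and> y j \<le> b j}"
proof -
  have "{y. \<forall>j. a j \<le> y j \<and> y j \<le> b j} = (\<Pi>\<^sub>E j\<in>UNIV. {a j..b j})" by auto
  moreover have "compactin (product_topology (\<lambda>_. euclidean) UNIV) (\<Pi>\<^sub>E j\<in>UNIV. {a j..b j})"
    by (simp add: compactin_PiE)
  ultimately show ?thesis by (simp add: euclidean_product_topology)
qed

context fk_chain
begin

lemma equilibrium_translate: "equilibrium h F x \<Longrightarrow> equilibrium h F (translate q p x)"
proof -
  assume x: "equilibrium h F x"
  have "force (x (n - 1 - q)) (x (n - q)) (x (n + 1 - q)) = F" for n
  proof -
    have "n - 1 - q = (n - q) - 1" "n + 1 - q = (n - q) + 1" by auto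
    then show ?thesis using x unfolding equilibrium_iff by metis
  qed
  then show ?thesis
    by (simp add: equilibrium_iff translate_def force_shift)
qed

text \<open>
The deviation of a Birkhoff equilibrium from its mean spacing is at most 1, so normalized Birkhoff
equilibria lie in a compact product of intervals. A limit point is an equilibrium of bounded
deviation, and serves both as subsolution and as supersolution; this yields a Birkhoff equilibrium
that even has the required type if the limit \<omega> is rational.
\<close>

lemma birkhoff_equilibrium_limit:
  assumes ex: "\<And>k::nat. \<exists>x. birkhoff_equilibrium h (F k) (w k) x"
    and F: "F \<longlonglongrightarrow> f" and w: "w \<longlonglongrightarrow> \<omega>"
  shows "\<exists>x. birkhoff_equilibrium h f \<omega> x"
proof -
  from ex obtain x where x: "\<And>k. birkhoff_equilibrium h (F k) (w k) (x k)" by metis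
  define y where "y k = translate 0 (- \<lfloor>x k 0\<rfloor>) (x k)" for k
  have y_eq: "equilibrium h (F k) (y k)" for k
    using x[of k] unfolding y_def birkhoff_equilibrium_def by (intro equilibrium_translate) blast
  have y_dev: "\<bar>y k n - y k 0 - of_int n * w k\<bar> \<le> 1" for k n
    using x[of k] birkhoff_deviation[of "x k" "w k" n 0]
    unfolding birkhoff_equilibrium_def y_def translate_def by simp
  have y0: "0 \<le> y k 0" "y k 0 \<le> 1" for k
    unfolding y_def translate_def of_int_minus by (simp; linarith)+
  have "Bseq w" using w by (intro convergent_imp_Bseq) (auto simp: convergent_def)
  then obtain M where M: "\<And>k. \<bar>w k\<bar> \<le> M" by (auto simp: Bseq_def)
  define B where "B n = \<bar>of_int n\<bar> * M + 2" for n :: int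
  have "y k \<in> {y. \<forall>j. - B j \<le> y j \<and> y j \<le> B j}" for k
  proof -
    have "- B n \<le> y k n \<and> y k n \<le> B n" for n
    proof -
      have "\<bar>of_int n * w k\<bar> \<le> \<bar>of_int n\<bar> * M"
        using M[of k] by (simp add: abs_mult mult_left_mono)
      then show ?thesis using y_dev[of k n] y0[of k] unfolding B_def by linarith
    qed
    then show ?thesis by simp
  qed
  then have y_box: "\<forall>k. y k \<in> {y. \<forall>j. - B j \<le> y j \<and> y j \<le> B j}" by blast
  have "seq_compact {y. \<forall>j. - B j \<le> y j \<and> y j \<le> B j}"
    by (intro compact_imp_seq_compact compact_int_box)
  from this y_box obtain l r where r: "strict_mono r" and lim: "(y \<circ> r) \<longlonglongrightarrow> l"
    by (rule seq_compactE)
  have lim_n: "(\<lambda>k. y (r k) n) \<longlonglongrightarrow> l n" for n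
  proof -
    have "continuous_on UNIV (\<lambda>x::int \<Rightarrow> real. x n)"
      by (rule continuous_on_product_coordinates)
    then have "isCont (\<lambda>x::int \<Rightarrow> real. x n) l"
      unfolding continuous_on_eq_continuous_at[OF open_UNIV] by blast
    from isCont_tendsto_compose[OF this lim] show ?thesis by (simp add: o_def)
  qed
  have F_r: "(\<lambda>k. F (r k)) \<longlonglongrightarrow> f" and w_r: "(\<lambda>k. w (r k)) \<longlonglongrightarrow> \<omega>"
    using LIMSEQ_subseq_LIMSEQ[OF F r] LIMSEQ_subseq_LIMSEQ[OF w r] by (simp_all add: o_def)
  have "force (l (n - 1)) (l n) (l (n + 1)) = f" for n
  proof -
    have "(\<lambda>k. force (y (r k) (n - 1)) (y (r k) n) (y (r k) (n + 1)))
        \<longlonglongrightarrow> force (l (n - 1)) (l n) (l (n + 1))"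
      by (intro tendsto_force lim_n)
    moreover have "force (y (r k) (n - 1)) (y (r k) n) (y (r k) (n + 1)) = F (r k)" for k
      using y_eq[of "r k"] by (simp add: equilibrium_iff)
    ultimately show ?thesis using F_r LIMSEQ_unique by simp
  qed
  then have l_eq: "equilibrium h f l" by (simp add: equilibrium_iff)
  have l_dev: "\<bar>l n - l 0 - of_int n * \<omega>\<bar> \<le> 1" for n
  proof (rule LIMSEQ_le_const2)
    show "(\<lambda>k. \<bar>y (r k) n - y (r k) 0 - of_int n * w (r k)\<bar>) \<longlonglongrightarrow> \<bar>l n - l 0 - of_int n * \<omega>\<bar>"
      by (intro tendsto_intros lim_n w_r)
  qed (use y_dev in blast)
  have "\<bar>l n - of_int n * \<omega>\<bar> \<le> 1 + \<bar>l 0\<bar>" for n using l_dev[of n] by linarith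
  then have "bounded_deviation \<omega> l" unfolding bounded_deviation_def by blast
  with l_eq show ?thesis
    using birkhoff_equilibrium_between[of f l \<omega> l] by (simp add: equilibrium_iff_sub_super)
qed

section \<open>Equilibria at zero tilt\<close>

lemma h_has_derivative:
  "((\<lambda>(x, y). h x y) has_derivative (\<lambda>(u, v). D1 h x y * u + D2 h x y * v)) (at (x, y))"
proof -
  have "((\<lambda>(x, y). h x y) has_derivative
      (\<lambda>(u, v). D1 h x y * u + blinfun_apply (blinfun_mult_right (D2 h x y)) v)) (at (x, y) within UNIV \<times> UNIV)"
  proof (rule has_derivative_partialsI)
    show "((\<lambda>x. h x y) has_derivative (*) (D1 h x y)) (at x)"
      using D1_has_derivative by (simp add: has_field_derivative_def)
    show "((\<lambda>y. h x y) has_derivative blinfun_apply (blinfun_mult_right (D2 h x y))) (at y)" for x y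
      using D2_has_derivative by (simp add: has_field_derivative_def)
    have "continuous (at (x, y)) (\<lambda>p. case p of (x, y) \<Rightarrow> D2 h x y)"
      using continuous_D2 by (simp add: continuous_on_eq_continuous_at)
    from bounded_linear.continuous[OF bounded_linear_blinfun_mult_right this]
    show "continuous (at (x, y) within UNIV \<times> UNIV) (\<lambda>(x, y). blinfun_mult_right (D2 h x y))"
      by (simp add: case_prod_unfold)
  qed auto
  then show ?thesis by simp
qed

lemma h_directional_derivative:
  "((\<lambda>t. h (x + t * u) (y + t * v)) has_real_derivative D1 h x y * u + D2 h x y * v) (at 0)"
proof -
  have "((\<lambda>t. (x + t * u, y + t * v)) has_derivative (\<lambda>t. (t * u, t * v))) (at 0)"
    by (auto intro!: derivative_eq_intros)
  from has_derivative_compose[OF this, of "\<lambda>(x, y). h x y" "\<lambda>(u, v). D1 h x y * u + D2 h x y * v"]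
    h_has_derivative[of x y]
  have "((\<lambda>t. h (x + t * u) (y + t * v)) has_derivative (\<lambda>t. D1 h x y * (t * u) + D2 h x y * (t * v))) (at 0)"
    by simp
  then show ?thesis
    unfolding has_field_derivative_def
    by (rule has_derivative_eq_rhs) (auto simp: algebra_simps)
qed

lemma continuous_h: "continuous_on UNIV (\<lambda>(x, y). h x y)"
  unfolding continuous_on_eq_continuous_at[OF open_UNIV]
  using has_derivative_continuous[OF h_has_derivative] by force

lemma h_shift: "h (x + of_int m) (y + of_int m) = h x y"
proof (induction m rule: int_induct[where k = 0])
  case (step1 i)
  then show ?case using h_periodic[of "x + of_int i" "y + of_int i"] by (simp add: add.assoc)
next
  case (step2 i)
  then show ?case
    using h_periodic[of "x + of_int (i - 1)" "y + of_int (i - 1)"] by (simp add: add.assoc)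
qed simp

text \<open>
The sum is the action per period of the configuration n \<mapsto> y (n * p), for coprime p and q. It is
invariant under integer shifts, so that the minimum may be sought in a compact set.
\<close>

lemma staircase_minimum_exists:
  assumes q: "q > 0"
  obtains y where "staircase q y"
    "\<And>z. staircase q z \<Longrightarrow> (\<Sum>j\<in>{0..<q}. h (y j) (y (j + p))) \<le> (\<Sum>j\<in>{0..<q}. h (z j) (z (j + p)))"
proof -
  define W where "W y = (\<Sum>j\<in>{0..<q}. h (y j) (y (j + p)))" for y :: "int \<Rightarrow> real"
  define B where "B j = \<bar>of_int j / of_int q\<bar> + (2::real)" for j :: int
  define K where "K = {y. \<forall>j. - B j \<le> y j \<and> y j \<le> B j} \<inter> {y. staircase q y \<and> 0 \<le> y 0 \<and> y 0 \<le> 1}"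
  have coord: "continuous_on S (\<lambda>y::int \<Rightarrow> real. y j)" for j S
    by (rule continuous_on_subset[OF continuous_on_product_coordinates]) simp
  have "closed {y. staircase q y \<and> 0 \<le> y 0 \<and> y 0 \<le> 1}"
  proof -
    have "closed {y::int \<Rightarrow> real. i \<le> j \<longrightarrow> y i \<le> y j}" for i j
      by (cases "i \<le> j") (auto intro!: closed_Collect_le coord)
    then show ?thesis
      unfolding staircase_def mono_def
      by (intro closed_Collect_conj closed_Collect_all closed_Collect_le closed_Collect_eq
          coord continuous_intros) auto
  qed
  then have "compact K" unfolding K_def by (intro compact_Int_closed compact_int_box)
  moreover have in_K: "z \<in> K" if "staircase q z" "0 \<le> z 0" "z 0 \<le> 1" for z
  proof -
    have "- B j \<le> z j \<and> z j \<le> B j" for j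
      using staircase_deviation[OF that(1) q, of j 0] that(2,3)
      unfolding B_def diff_0_right by linarith
    then show ?thesis using that by (simp add: K_def)
  qed
  have "staircase q (\<lambda>j. of_int j / of_int q)"
    using q by (auto simp: staircase_def add_divide_distrib intro!: monoI divide_right_mono)
  from in_K[OF this] have "K \<noteq> {}" by auto
  moreover have "continuous_on K W"
    unfolding W_def
  proof (rule continuous_on_sum)
    fix j
    have "continuous_on K (\<lambda>y. case (y j, y (j + p)) of (x, y) \<Rightarrow> h x y)"
      by (rule continuous_on_compose2[OF continuous_h]) (auto intro!: continuous_on_Pair coord)
    then show "continuous_on K (\<lambda>y. h (y j) (y (j + p)))" by simp
  qed
  ultimately obtain y where y: "y \<in> K" "\<And>z. z \<in> K \<Longrightarrow> W y \<le> W z"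
    using continuous_attains_inf by metis
  show thesis
  proof (rule that)
    show "staircase q y" using y(1) by (simp add: K_def)
    fix z assume z: "staircase q z"
    let ?z = "\<lambda>j. z j + of_int (- \<lfloor>z 0\<rfloor>)"
    have "?z \<in> K"
      using z by (intro in_K) (auto simp: staircase_def mono_def, linarith+)
    from y(2)[OF this] show "(\<Sum>j\<in>{0..<q}. h (y j) (y (j + p))) \<le> (\<Sum>j\<in>{0..<q}. h (z j) (z (j + p)))"
      unfolding W_def h_shift .
  qed
qed


lemma staircase_force_periodic:
  assumes "staircase q y"
  shows "force (y (j + q - p)) (y (j + q)) (y (j + q + p)) = force (y (j - p)) (y j) (y (j + p))"
proof -
  have "y (j + q - p) = y (j - p) + 1" "y (j + q) = y j + 1" "y (j + q + p) = y (j + p) + 1"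
    using staircase_shift[OF assms, of "j - p" 1] staircase_shift[OF assms, of j 1]
      staircase_shift[OF assms, of "j + p" 1] by (simp_all add: algebra_simps)
  then show ?thesis
    using force_shift[of "y (j - p)" 1 "y j" "y (j + p)"] by simp
qed

text \<open>
Gradient descent does not leave the set of staircases: where two consecutive values agree, the
force is not larger at the second of them by cooperativity, so they move apart.
\<close>

lemma staircase_descent:
  assumes y: "staircase q y" and q: "q > 0"
  shows "\<forall>\<^sub>F t in at_right 0.
    staircase q (\<lambda>j. y j - t * force (y (j - p)) (y j) (y (j + p)))"
proof -
  define f where "f j = force (y (j - p)) (y j) (y (j + p))" for j
  have f_per: "f (j + q) = f j" for j
    unfolding f_def by (rule staircase_force_periodic[OF y])
  have y_step: "y j \<le> y (j + 1)" for j
    using y by (simp add: staircase_def mono_def)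
  have "\<forall>\<^sub>F t in at_right 0. y j - t * f j \<le> y (j + 1) - t * f (j + 1)" for j
  proof (cases "y j = y (j + 1)")
    case True
    have "f (j + 1) \<le> f j"
      using y_step[of "j - p"] y_step[of "j + p"] True
      by (simp add: f_def algebra_simps force_antimono)
    then have "y j - t * f j \<le> y (j + 1) - t * f (j + 1)" if "t > 0" for t
      using True that by (simp add: mult_left_mono)
    then show ?thesis using eventually_at_right_less[of "0::real"] by (auto elim: eventually_mono)
  next
    case False
    have "((\<lambda>t. y j - t * f j - (y (j + 1) - t * f (j + 1))) \<longlongrightarrow> y j - 0 * f j - (y (j + 1) - 0 * f (j + 1)))
        (at_right 0)"
      by (intro tendsto_intros)
    moreover have "y j - 0 * f j - (y (j + 1) - 0 * f (j + 1)) < 0" using False y_step[of j] by simp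
    ultimately have "\<forall>\<^sub>F t in at_right 0. y j - t * f j - (y (j + 1) - t * f (j + 1)) < 0"
      by (rule order_tendstoD(2))
    then show ?thesis by (rule eventually_mono) simp
  qed
  then have "\<forall>\<^sub>F t in at_right 0. \<forall>j\<in>{0..<q}. y j - t * f j \<le> y (j + 1) - t * f (j + 1)"
    by (intro eventually_ball_finite) auto
  then show ?thesis
    unfolding f_def[symmetric]
  proof eventually_elim
    case (elim t)
    show "staircase q (\<lambda>j. y j - t * f j)"
      using elim staircase_shift[OF y, of _ 1] q by (intro staircaseI) (simp_all add: f_per)
  qed
qed

text \<open>
A minimum of the action over staircases is a constrained one, but the direction of steepest descent
is admissible, so the derivative in this direction, minus the sum of squared forces, vanishes.
\<close>

lemma periodic_equilibrium_exists:
  assumes q: "q > 0"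
  obtains y where "staircase q y" "\<And>j. force (y (j - p)) (y j) (y (j + p)) = 0"
proof -
  obtain y where y: "staircase q y" and y_min: "\<And>z. staircase q z \<Longrightarrow>
      (\<Sum>j\<in>{0..<q}. h (y j) (y (j + p))) \<le> (\<Sum>j\<in>{0..<q}. h (z j) (z (j + p)))"
    using staircase_minimum_exists[OF q, of p] by blast
  define f where "f j = force (y (j - p)) (y j) (y (j + p))" for j
  have y_shift: "y (j + q) = y j + 1" for j using y by (simp add: staircase_def)
  have f_per: "f (j + q) = f j" for j
    unfolding f_def by (rule staircase_force_periodic[OF y])
  define W where "W t = (\<Sum>j\<in>{0..<q}. h (y j + t * - f j) (y (j + p) + t * - f (j + p)))" for t
  have "(W has_real_derivative
      (\<Sum>j\<in>{0..<q}. D1 h (y j) (y (j + p)) * - f j + D2 h (y j) (y (j + p)) * - f (j + p))) (at 0)"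
    unfolding W_def by (intro DERIV_sum h_directional_derivative)
  moreover have "(\<Sum>j\<in>{0..<q}. D1 h (y j) (y (j + p)) * - f j + D2 h (y j) (y (j + p)) * - f (j + p))
      = - (\<Sum>j\<in>{0..<q}. (f j)\<^sup>2)"
  proof -
    define g where "g j = D2 h (y (j - p)) (y j) * - f j" for j
    have "g (j + q) = g j" for j
    proof -
      have "y (j + q - p) = y (j - p) + 1"
        using y_shift[of "j - p"] by (simp add: algebra_simps)
      then show ?thesis by (simp add: g_def f_per y_shift D2_periodic)
    qed
    from sum_periodic_shift[of g, OF this q, of p]
    have "(\<Sum>j\<in>{0..<q}. D2 h (y j) (y (j + p)) * - f (j + p)) = (\<Sum>j\<in>{0..<q}. D2 h (y (j - p)) (y j) * - f j)"
      by (simp add: g_def)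
    then have "(\<Sum>j\<in>{0..<q}. D1 h (y j) (y (j + p)) * - f j + D2 h (y j) (y (j + p)) * - f (j + p))
      = (\<Sum>j\<in>{0..<q}. D1 h (y j) (y (j + p)) * - f j + D2 h (y (j - p)) (y j) * - f j)"
      by (simp only: sum.distrib)
    also have "\<dots> = (\<Sum>j\<in>{0..<q}. - (f j)\<^sup>2)"
      by (intro sum.cong refl) (simp add: f_def force_def power2_eq_square algebra_simps)
    finally show ?thesis by (simp add: sum_negf)
  qed
  ultimately have deriv: "(W has_real_derivative - (\<Sum>j\<in>{0..<q}. (f j)\<^sup>2)) (at 0)" by simp
  have "\<not> - (\<Sum>j\<in>{0..<q}. (f j)\<^sup>2) < 0"
  proof
    assume "- (\<Sum>j\<in>{0..<q}. (f j)\<^sup>2) < 0"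
    from DERIV_neg_dec_right[OF deriv this] obtain d where d: "d > 0" "\<And>t. 0 < t \<Longrightarrow> t < d \<Longrightarrow> W t < W 0"
      by auto
    have "\<forall>\<^sub>F t in at_right 0. t \<in> {0<..<d}"
      using d(1) by (rule eventually_at_right_real)
    with staircase_descent[OF y q, of p]
    have "\<forall>\<^sub>F t in at_right 0. staircase q (\<lambda>j. y j - t * f j) \<and> t \<in> {0<..<d}"
      unfolding f_def by (rule eventually_conj)
    then obtain t where t: "staircase q (\<lambda>j. y j - t * f j)" "t \<in> {0<..<d}"
      using eventually_happens'[OF trivial_limit_at_right_real] by blast
    then have "W 0 \<le> W t" using y_min[OF t(1)] by (simp add: W_def)
    with d(2)[of t] t(2) show False by simp
  qed
  then have "(\<Sum>j\<in>{0..<q}. (f j)\<^sup>2) = 0"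
    using sum_nonneg[of "{0..<q}" "\<lambda>j. (f j)\<^sup>2"] by force
  then have zero: "f j = 0" if "j \<in> {0..<q}" for j
    using that by (subst (asm) sum_nonneg_eq_0_iff) auto
  have "f j = 0" for j
  proof -
    have "f (j mod q) = 0" using q by (intro zero) simp
    moreover have "f (j mod q + (j div q) * q) = f (j mod q)"
      using periodic_int_shift[of f q 0 "j mod q" "j div q"] f_per by simp
    ultimately show ?thesis by simp
  qed
  with y show thesis by (intro that[of y]) (simp_all add: f_def)
qed

section \<open>The depinning force\<close>

definition admits :: "real \<Rightarrow> real \<Rightarrow> bool" where
  "admits F \<omega> \<longleftrightarrow> (\<exists>x. birkhoff_equilibrium h F \<omega> x)"

lemma admits_equilibrium:
  assumes "admits F \<omega>"
  shows "\<exists>x. equilibrium h F x \<and> bounded_deviation \<omega> x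
    \<and> (\<forall>n m. \<bar>x n - x m - of_int (n - m) * \<omega>\<bar> \<le> 1)"
proof -
  obtain x where x: "equilibrium h F x" "birkhoff x" "has_mean_spacing x \<omega>"
    using assms unfolding admits_def birkhoff_equilibrium_def by blast
  have dev: "\<bar>x n - x m - of_int (n - m) * \<omega>\<bar> \<le> 1" for n m
    by (rule birkhoff_deviation[OF x(2,3)])
  have "\<bar>x n - of_int n * \<omega>\<bar> \<le> 1 + \<bar>x 0\<bar>" for n
    using dev[of n 0] by simp
  then have "bounded_deviation \<omega> x" unfolding bounded_deviation_def by blast
  with x(1) dev show ?thesis by blast
qed

lemma admits_zero_rational:
  assumes q: "q > 0"
  shows "admits 0 (of_int p / of_int q)"
proof -
  obtain y where y: "staircase q y" "\<And>j. force (y (j - p)) (y j) (y (j + p)) = 0"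
    using periodic_equilibrium_exists[OF q, of p] by blast
  define x where "x n = y (n * p)" for n
  have "force (x (n - 1)) (x n) (x (n + 1)) = 0" for n
    using y(2)[of "n * p"] by (simp add: x_def algebra_simps)
  then have eq: "equilibrium h 0 x" by (simp add: equilibrium_iff)
  have "\<bar>x n - of_int n * (of_int p / of_int q)\<bar> \<le> 1 + \<bar>y 0\<bar>" for n
    using staircase_deviation[OF y(1) q, of "n * p" 0] by (simp add: x_def)
  then have "bounded_deviation (of_int p / of_int q) x" unfolding bounded_deviation_def by blast
  with eq show ?thesis
    using birkhoff_equilibrium_between[of 0 x _ x] by (simp add: equilibrium_iff_sub_super admits_def)
qed

lemma admits_limit:
  assumes "\<And>k::nat. admits (F k) (w k)" "F \<longlonglongrightarrow> f" "w \<longlonglongrightarrow> \<omega>"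
  shows "admits f \<omega>"
  using assms unfolding admits_def by (rule birkhoff_equilibrium_limit)

text \<open>
Irrational mean spacings are reached from rational ones by compactness.
\<close>

lemma admits_zero: "admits 0 \<omega>"
proof (rule admits_limit)
  fix k
  show "admits 0 (of_int \<lfloor>\<omega> * of_int (int k + 1)\<rfloor> / of_int (int k + 1))"
    by (rule admits_zero_rational) simp
next
  have "(\<lambda>k. of_int \<lfloor>\<omega> * of_int (int k + 1)\<rfloor> / of_int (int k + 1) - \<omega>) \<longlonglongrightarrow> 0"
  proof (rule Lim_null_comparison)
    show "\<forall>\<^sub>F k in sequentially.
        norm (of_int \<lfloor>\<omega> * of_int (int k + 1)\<rfloor> / of_int (int k + 1) - \<omega>) \<le> inverse (real (Suc k))"
    proof (rule always_eventually, rule allI)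
      fix k
      define r where "r = real (Suc k)"
      have r: "r > 0" "of_int (int k + 1) = r" by (simp_all add: r_def)
      have "of_int \<lfloor>\<omega> * r\<rfloor> / r - \<omega> = (of_int \<lfloor>\<omega> * r\<rfloor> - \<omega> * r) / r"
        using r by (simp add: field_simps)
      moreover have "\<bar>of_int \<lfloor>\<omega> * r\<rfloor> - \<omega> * r\<bar> \<le> 1" by linarith
      ultimately have "\<bar>of_int \<lfloor>\<omega> * r\<rfloor> / r - \<omega>\<bar> \<le> 1 / r"
        using r by (simp add: divide_right_mono)
      then show "norm (of_int \<lfloor>\<omega> * of_int (int k + 1)\<rfloor> / of_int (int k + 1) - \<omega>) \<le> inverse (real (Suc k))"
        unfolding r(2) r_def[symmetric] by (simp add: inverse_eq_divide)
    qed
    show "(\<lambda>k. inverse (real (Suc k))) \<longlonglongrightarrow> 0" by (rule LIMSEQ_inverse_real_of_nat)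
  qed
  then show "(\<lambda>k. of_int \<lfloor>\<omega> * of_int (int k + 1)\<rfloor> / of_int (int k + 1)) \<longlonglongrightarrow> \<omega>"
    by (rule LIM_zero_cancel)
qed simp

text \<open>
An equilibrium at zero tilt is a subsolution for every nonnegative tilt. Hence to bound the
depinning force from below one only has to produce supersolutions.
\<close>

lemma admits_supersolution:
  assumes "supersolution F u" "bounded_deviation \<omega> u" "F \<ge> 0"
  shows "admits F \<omega>"
proof -
  obtain v where v: "equilibrium h 0 v" "bounded_deviation \<omega> v"
    using admits_equilibrium[OF admits_zero] by blast
  then have "subsolution F v"
    using assms(3) by (simp add: equilibrium_iff subsolution_def)
  with assms v show ?thesis unfolding admits_def by (intro birkhoff_equilibrium_between)
qed

lemma admits_downward:
  assumes "admits F \<omega>" "0 \<le> F'" "F' \<le> F"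
  shows "admits F' \<omega>"
proof -
  obtain u where u: "equilibrium h F u" "bounded_deviation \<omega> u"
    using admits_equilibrium[OF assms(1)] by blast
  then have "supersolution F' u"
    using assms(3) by (simp add: equilibrium_iff supersolution_def)
  with u assms show ?thesis by (intro admits_supersolution)
qed

lemma admits_bounded: obtains C where "\<And>F. admits F \<omega> \<Longrightarrow> F \<le> C"
proof -
  obtain C where C: "\<And>a b d. \<bar>a - b\<bar> \<le> 1 + \<bar>\<omega>\<bar> \<Longrightarrow> \<bar>d - b\<bar> \<le> 1 + \<bar>\<omega>\<bar> \<Longrightarrow> \<bar>force a b d\<bar> \<le> C"
    using force_bounded[of "1 + \<bar>\<omega>\<bar>"] by blast
  show thesis
  proof (rule that)
    fix F assume "admits F \<omega>"
    then obtain x where x: "equilibrium h F x" "\<And>n m. \<bar>x n - x m - of_int (n - m) * \<omega>\<bar> \<le> 1"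
      using admits_equilibrium by blast
    have "\<bar>force (x (- 1)) (x 0) (x 1)\<bar> \<le> C"
      using x(2)[of "- 1" 0] x(2)[of 1 0] by (intro C) simp_all
    moreover have "force (x (0 - 1)) (x 0) (x (0 + 1)) = F"
      using x(1) unfolding equilibrium_iff by blast
    ultimately show "F \<le> C" by simp
  qed
qed

text \<open>
The tilts admitting a Birkhoff equilibrium of mean spacing \<omega> form a compact interval starting at 0;
this makes the definite description well-defined.
\<close>

lemma depinning_force_nonneg: "0 \<le> depinning_force h \<omega>"
  and admits_iff: "F \<ge> 0 \<Longrightarrow> admits F \<omega> \<longleftrightarrow> F \<le> depinning_force h \<omega>"
proof -
  define S where "S = {F. 0 \<le> F \<and> admits F \<omega>}"
  define D where "D = Sup S"
  obtain C where "\<And>F. admits F \<omega> \<Longrightarrow> F \<le> C" using admits_bounded[of \<omega>] by blast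
  then have bdd: "bdd_above S" by (intro bdd_aboveI[of _ C]) (auto simp: S_def)
  have zero: "0 \<in> S" by (simp add: S_def admits_zero)
  have D0: "D \<ge> 0" unfolding D_def by (rule cSup_upper[OF zero bdd])
  have "\<exists>F\<in>S. D - inverse (real (Suc k)) < F" for k
    using zero bdd by (subst less_cSup_iff[symmetric]) (auto simp: D_def)
  then obtain G where G: "\<And>k. G k \<in> S" "\<And>k. D - inverse (real (Suc k)) < G k" by metis
  have "G \<longlonglongrightarrow> D"
  proof (rule tendsto_sandwich)
    show "\<forall>\<^sub>F k in sequentially. D - inverse (real (Suc k)) \<le> G k"
      by (intro always_eventually allI less_imp_le G(2))
    show "\<forall>\<^sub>F k in sequentially. G k \<le> D"
      unfolding D_def by (intro always_eventually allI cSup_upper G(1) bdd)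
    show "(\<lambda>k. D - inverse (real (Suc k))) \<longlonglongrightarrow> D"
      using tendsto_diff[OF tendsto_const LIMSEQ_inverse_real_of_nat, of D] by simp
  qed auto
  then have "admits D \<omega>"
    using G(1) by - (rule admits_limit[of G "\<lambda>_. \<omega>" D \<omega>], auto simp: S_def)
  then have below: "admits F \<omega>" if "0 \<le> F" "F \<le> D" for F
    using admits_downward that by blast
  have above: "\<not> admits F \<omega>" if "F > D" for F
  proof
    assume "admits F \<omega>"
    then have "F \<in> S" using that D0 by (simp add: S_def)
    from cSup_upper[OF this bdd] show False using that by (simp add: D_def)
  qed
  have "depinning_force h \<omega> = D"
    unfolding depinning_force_def admits_def[symmetric]
  proof (rule the_equality)
    fix E assume E: "0 \<le> E \<and> (\<forall>F. 0 \<le> F \<and> F \<le> E \<longrightarrow> admits F \<omega>) \<and> (\<forall>F. E < F \<longrightarrow> \<not> admits F \<omega>)"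
    then have "\<not> D < E" using above by blast
    moreover have "\<not> E < D" using E \<open>admits D \<omega>\<close> by blast
    ultimately show "E = D" by simp
  qed (use D0 below above in blast)
  then show "0 \<le> depinning_force h \<omega>" "F \<ge> 0 \<Longrightarrow> admits F \<omega> \<longleftrightarrow> F \<le> depinning_force h \<omega>"
    using D0 below above by (auto simp: not_le[symmetric])
qed

lemma depinning_force_upper_semicontinuous:
  assumes "depinning_force h \<omega> < a"
  shows "\<forall>\<^sub>F w in nhds \<omega>. depinning_force h w < a"
proof (rule ccontr)
  assume not: "\<not> ?thesis"
  have "\<exists>w. dist w \<omega> < inverse (real (Suc k)) \<and> a \<le> depinning_force h w" for k
    using not unfolding eventually_nhds_metric
    by (auto simp: not_less dest!: spec[of _ "inverse (real (Suc k))"])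
  then obtain w where w: "\<And>k. dist (w k) \<omega> < inverse (real (Suc k))" "\<And>k. a \<le> depinning_force h (w k)"
    by metis
  have a: "a \<ge> 0" using assms depinning_force_nonneg[of \<omega>] by linarith
  have "(\<lambda>k. w k - \<omega>) \<longlonglongrightarrow> 0"
  proof (rule Lim_null_comparison[OF always_eventually LIMSEQ_inverse_real_of_nat], rule allI)
    show "norm (w k - \<omega>) \<le> inverse (real (Suc k))" for k
      using w(1)[of k] by (simp only: dist_norm less_imp_le)
  qed
  then have "w \<longlonglongrightarrow> \<omega>" by (rule LIM_zero_cancel)
  moreover have "admits a (w k)" for k using w(2)[of k] a by (simp add: admits_iff)
  ultimately have "admits a \<omega>" using admits_limit[of "\<lambda>_. a" w a \<omega>] by simp
  with assms a show False by (simp add: admits_iff)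
qed

end

section \<open>Order patterns of step functions\<close>

lemma staircase_index:
  assumes s: "staircase N s" and N: "N > 0"
  shows "\<exists>i. s i \<le> t \<and> t < s (i + 1)"
proof (rule ccontr)
  assume none: "\<not> ?thesis"
  define m where "m = \<lfloor>t - s 0\<rfloor>"
  have "s (0 + m * N) \<le> t" "t < s (0 + (m + 1) * N)"
    unfolding staircase_shift[OF s] m_def by linarith+
  then have start: "s (m * N) \<le> t" and stop: "t < s ((m + 1) * N)" by simp_all
  have "s i \<le> t" if "m * N \<le> i" for i
    using that
  proof (induction rule: int_ge_induct)
    case base
    then show ?case using start by simp
  next
    case (step i)
    then show ?case using none by (auto simp: not_less)
  qed
  moreover have "m * N \<le> (m + 1) * N" using N by (simp add: distrib_right)
  ultimately show False using stop by force
qed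

text \<open>
The force balance of a step function at t involves only the steps containing t - \<omega>, t and t + \<omega>.
Which triples of steps occur is determined by the order of the numbers s i + l * \<omega> for l in
{-1, 0, 1}, hence by comparisons in which \<omega> has a coefficient k between -2 and 2.
\<close>

definition same_pattern :: "(int \<Rightarrow> real) \<Rightarrow> real \<Rightarrow> (int \<Rightarrow> real) \<Rightarrow> real \<Rightarrow> bool" where
  "same_pattern s \<omega> s' \<omega>' \<longleftrightarrow>
     (\<forall>i j. \<forall>k\<in>{-2..2::int}. s i + of_int k * \<omega> < s j \<longleftrightarrow> s' i + of_int k * \<omega>' < s' j)"

text \<open>
Up to integer translation only the comparisons with these indices are open: for |j - i| larger
than N * (2 * K + 1) the distance between s i and s j exceeds 2 * K. So only finitely many patterns
exist for mean spacings in [-K, K].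
\<close>

definition pattern_indices :: "int \<Rightarrow> real \<Rightarrow> (int \<times> int \<times> int) set" where
  "pattern_indices N K = {0..<N} \<times> {- \<lceil>of_int N * (2 * K + 1)\<rceil>..N + \<lceil>of_int N * (2 * K + 1)\<rceil>} \<times> {-2..2}"

lemma finite_pattern_indices: "finite (pattern_indices N K)"
  unfolding pattern_indices_def by simp

lemma same_pattern_if_on_indices:
  assumes s: "staircase N s" and s': "staircase N s'" and N: "N > 0"
    and K: "\<bar>\<omega>\<bar> \<le> K" "\<bar>\<omega>'\<bar> \<le> K"
    and agree: "\<And>i j k. (i, j, k) \<in> pattern_indices N K \<Longrightarrow>
      s i + of_int k * \<omega> < s j \<longleftrightarrow> s' i + of_int k * \<omega>' < s' j"
  shows "same_pattern s \<omega> s' \<omega>'"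
  unfolding same_pattern_def
proof (intro allI ballI)
  fix i j k :: int
  assume k: "k \<in> {-2..2}"
  define J where "J = \<lceil>of_int N * (2 * K + 1)\<rceil>"
  define i' where "i' = i mod N"
  define j' where "j' = j - (i div N) * N"
  have ij: "i = i' + (i div N) * N" "j = j' + (i div N) * N"
    by (simp_all add: i'_def j'_def)
  have i': "i' \<in> {0..<N}" using N by (simp add: i'_def)
  have kK: "\<bar>of_int k * w\<bar> \<le> 2 * K" if "\<bar>w\<bar> \<le> K" for w :: real
  proof -
    have "of_int \<bar>k\<bar> \<le> (of_int 2 :: real)" using k by (subst of_int_le_iff) auto
    then have "\<bar>of_int k\<bar> \<le> (2::real)" by simp
    then show ?thesis using that by (simp add: abs_mult mult_mono')
  qed
  have far: "r i' + of_int k * w < r j' \<longleftrightarrow> i' < j'"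
    if r: "staircase N r" and w: "\<bar>w\<bar> \<le> K" and J: "\<bar>j' - i'\<bar> > J" for r w
  proof -
    have "of_int N * (2 * K + 1) < \<bar>of_int (j' - i')\<bar>"
      using J unfolding J_def by linarith
    then have "2 * K + 1 < \<bar>of_int (j' - i') / of_int N\<bar>"
      using N by (simp add: pos_less_divide_eq mult.commute)
    moreover have "of_int (j' - i') / (of_int N :: real) \<ge> 0 \<longleftrightarrow> i' \<le> j'"
      using N by (simp add: zero_le_divide_iff)
    moreover note staircase_deviation[OF r N, of j' i'] kK[OF w]
    moreover have "i' \<noteq> j'"
    proof
      assume "i' = j'"
      then have "J < 0" using J by simp
      moreover have "of_int N * (2 * K + 1) \<ge> 0" using N w by simp
      ultimately show False unfolding J_def by linarith
    qed
    ultimately show ?thesis by linarith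
  qed
  have "s i' + of_int k * \<omega> < s j' \<longleftrightarrow> s' i' + of_int k * \<omega>' < s' j'"
  proof (cases "\<bar>j' - i'\<bar> \<le> J")
    case True
    then have "j' \<in> {-J..N + J}" using i' by auto
    then show ?thesis using i' k by (intro agree) (simp add: pattern_indices_def J_def)
  next
    case False
    then show ?thesis using far[OF s K(1)] far[OF s' K(2)] by simp
  qed
  moreover have "s i = s i' + of_int (i div N)" "s j = s j' + of_int (i div N)"
    "s' i = s' i' + of_int (i div N)" "s' j = s' j' + of_int (i div N)"
    using staircase_shift[OF s] staircase_shift[OF s'] ij by metis+
  ultimately show "s i + of_int k * \<omega> < s j \<longleftrightarrow> s' i + of_int k * \<omega>' < s' j" by auto
qed

text \<open>
A pattern is a system of strict and weak linear inequalities in s and \<omega>, hence defines a convex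
set.
\<close>

lemma same_pattern_convex:
  assumes "same_pattern s \<omega> s' \<omega>'" "0 \<le> u" "u \<le> 1"
  shows "same_pattern s \<omega> (\<lambda>j. (1 - u) * s j + u * s' j) ((1 - u) * \<omega> + u * \<omega>')"
  unfolding same_pattern_def
proof (intro allI ballI)
  fix i j k :: int
  assume "k \<in> {-2..2}"
  then have iff: "s i + of_int k * \<omega> < s j \<longleftrightarrow> s' i + of_int k * \<omega>' < s' j"
    using assms(1) unfolding same_pattern_def by blast
  define a where "a = s j - (s i + of_int k * \<omega>)"
  define b where "b = s' j - (s' i + of_int k * \<omega>')"
  have "a > 0 \<longleftrightarrow> b > 0" using iff by (simp add: a_def b_def)
  moreover have "a > 0 \<Longrightarrow> b > 0 \<Longrightarrow> (1 - u) * a + u * b > 0"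
    using assms(2,3) by (cases "u = 0") (auto intro: add_nonneg_pos)
  moreover have "a \<le> 0 \<Longrightarrow> b \<le> 0 \<Longrightarrow> (1 - u) * a + u * b \<le> 0"
    using assms(2,3) by (auto intro!: add_nonpos_nonpos mult_nonneg_nonpos)
  ultimately have "a > 0 \<longleftrightarrow> (1 - u) * a + u * b > 0" by linarith
  then show "s i + of_int k * \<omega> < s j \<longleftrightarrow>
      (1 - u) * s i + u * s' i + of_int k * ((1 - u) * \<omega> + u * \<omega>') < (1 - u) * s j + u * s' j"
    by (simp add: a_def b_def algebra_simps)
qed

lemma staircase_convex:
  assumes "staircase N s" "staircase N s'" "0 \<le> u" "u \<le> 1"
  shows "staircase N (\<lambda>j. (1 - u) * s j + u * s' j)"
  unfolding staircase_def
proof (intro conjI monoI allI)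
  fix i j :: int
  assume "i \<le> j"
  then show "(1 - u) * s i + u * s' i \<le> (1 - u) * s j + u * s' j"
    using assms by (intro add_mono mult_left_mono) (auto simp: staircase_def dest: monoD)
next
  fix j
  have "s (j + N) = s j + 1" "s' (j + N) = s' j + 1"
    using assms(1,2) by (simp_all add: staircase_def)
  then show "(1 - u) * s (j + N) + u * s' (j + N) = (1 - u) * s j + u * s' j + 1"
    by (simp add: distrib_left)
qed

context fk_chain
begin

text \<open>
The step function with value i / N on the interval from s i to s (i + 1) is a hull supersolution.
The statement in terms of the indices i, a, b avoids choosing this function.
\<close>

definition step_admissible :: "int \<Rightarrow> real \<Rightarrow> real \<Rightarrow> (int \<Rightarrow> real) \<Rightarrow> bool" where
  "step_admissible N F \<omega> s \<longleftrightarrow> staircase N s \<and>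
     (\<forall>t i a b. s i \<le> t \<and> t < s (i + 1) \<and> s a \<le> t - \<omega> \<and> t - \<omega> < s (a + 1)
        \<and> s b \<le> t + \<omega> \<and> t + \<omega> < s (b + 1) \<longrightarrow>
        F \<le> force (of_int a / of_int N) (of_int i / of_int N) (of_int b / of_int N))"

lemma step_admissible_imp_admits:
  assumes s: "step_admissible N F \<omega> s" and N: "N > 0" and F: "F \<ge> 0"
  shows "admits F \<omega>"
proof -
  have st: "staircase N s" using s by (simp add: step_admissible_def)
  obtain idx where idx: "\<And>t. s (idx t) \<le> t" "\<And>t. t < s (idx t + 1)"
    using staircase_index[OF st N] by metis
  define u where "u n = of_int (idx (of_int n * \<omega>)) / (of_int N :: real)" for n
  have "F \<le> force (u (n - 1)) (u n) (u (n + 1))" for n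
  proof -
    let ?t = "of_int n * \<omega>"
    have e: "of_int (n - 1) * \<omega> = ?t - \<omega>" "of_int (n + 1) * \<omega> = ?t + \<omega>"
      by (simp_all add: algebra_simps)
    show ?thesis
      unfolding u_def e using s idx unfolding step_admissible_def by blast
  qed
  then have "supersolution F u" by (simp add: supersolution_def)
  moreover have "\<bar>u n - of_int n * \<omega>\<bar> \<le> 2 + \<bar>s 0\<bar>" for n
  proof -
    let ?t = "of_int n * \<omega>" and ?i = "idx (of_int n * \<omega>)"
    have "of_int (?i + 1) / (of_int N :: real) \<le> of_int ?i / of_int N + 1"
      using N by (simp add: add_divide_distrib)
    then show ?thesis
      using staircase_deviation[OF st N, of ?i 0] staircase_deviation[OF st N, of "?i + 1" 0]
        idx(1)[of ?t] idx(2)[of ?t]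
      unfolding u_def diff_0_right by linarith
  qed
  then have "bounded_deviation \<omega> u" unfolding bounded_deviation_def by blast
  ultimately show ?thesis using F by (rule admits_supersolution)
qed

text \<open>
Rounding a hull function of an equilibrium at tilt F1 down to multiples of 1 / N changes the force
by at most F1 - F if N is large, uniformly in \<omega>. The jumps of the rounded function are at the
points s j where the hull function reaches the level j / N.
\<close>

lemma admits_imp_step_admissible:
  assumes "F < F1"
  obtains N where "N > 0" "\<And>\<omega>. \<bar>\<omega>\<bar> \<le> K \<Longrightarrow> admits F1 \<omega> \<Longrightarrow> \<exists>s. step_admissible N F \<omega> s"
proof -
  obtain \<delta> where mod: "force_modulus (K + 2) \<delta> (F1 - F)"
    using force_modulus_exists[of "F1 - F"] assms by auto
  then have \<delta>: "\<delta> > 0" by (simp add: force_modulus_def)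
  define N where "N = \<lceil>1 / \<delta>\<rceil>"
  have N: "N > 0" using \<delta> by (simp add: N_def)
  have "1 / \<delta> \<le> of_int N" by (simp add: N_def)
  then have N\<delta>: "1 / of_int N \<le> \<delta>" using \<delta> N by (simp add: field_simps)
  have "\<exists>s. step_admissible N F \<omega> s" if \<omega>: "\<bar>\<omega>\<bar> \<le> K" and adm: "admits F1 \<omega>" for \<omega>
  proof -
    obtain x where x: "equilibrium h F1 x" "bounded_deviation \<omega> x"
      using admits_equilibrium[OF adm] by blast
    obtain \<phi> where \<phi>: "hull_supersolution F1 \<omega> \<phi>"
      using hull_supersolution_exists[of F1 x \<omega>] x by (auto simp: equilibrium_iff_sub_super)
    then have deg: "degree_one \<phi>" by (simp add: hull_supersolution_def)
    then have "mono \<phi>" by (simp add: degree_one_def)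
    define A where "A j = {t. of_int j / of_int N \<le> \<phi> t}" for j :: int
    define s where "s j = Inf (A j)" for j
    have dev: "\<bar>\<phi> t - \<phi> 0 - t\<bar> \<le> 1" for t
      using degree_one_deviation[OF deg, of t 0] by simp
    have bdd: "bdd_below (A j)" for j
      by (rule bdd_belowI[of _ "of_int j / of_int N - \<phi> 0 - 1"])
        (use dev in \<open>auto simp: A_def abs_le_iff algebra_simps intro: order_trans\<close>)
    have ne: "A j \<noteq> {}" for j
    proof -
      have "of_int j / of_int N - \<phi> 0 + 1 \<in> A j"
        using dev[of "of_int j / of_int N - \<phi> 0 + 1"] unfolding A_def mem_Collect_eq by linarith
      then show ?thesis by blast
    qed
    have s_le: "s j \<le> t" if "of_int j / of_int N \<le> \<phi> t" for j t
      unfolding s_def by (rule cInf_lower[OF _ bdd]) (use that in \<open>simp add: A_def\<close>)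
    have below: "\<phi> t < of_int j / of_int N" if "t < s j" for t j
      using s_le[of j t] that by linarith
    have above: "of_int j / of_int N \<le> \<phi> t" if "s j < t" for t j
    proof -
      obtain t' where "t' \<in> A j" "t' < t" using cInf_lessD[OF ne] \<open>s j < t\<close> unfolding s_def by blast
      then show ?thesis using monoD[OF \<open>mono \<phi>\<close>, of t' t] by (simp add: A_def)
    qed
    have "mono s"
      unfolding s_def
    proof (intro monoI cInf_superset_mono ne bdd)
      fix i j :: int assume "i \<le> j"
      then have "of_int i / (of_int N :: real) \<le> of_int j / of_int N"
        using N by (simp add: divide_right_mono)
      then show "A j \<subseteq> A i" unfolding A_def by auto
    qed
    have N_shift: "of_int (j + N) / of_int N = of_int j / (of_int N :: real) + 1" for j
      using N by (simp add: add_divide_distrib)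
    have \<phi>_shift: "\<phi> (t + 1) = \<phi> t + 1" for t
      using deg by (simp add: degree_one_def)
    have "s (j + N) = s j + 1" for j
    proof (rule order_antisym)
      show "s (j + N) \<le> s j + 1"
      proof (rule field_le_epsilon)
        fix e :: real assume "e > 0"
        then have "of_int j / of_int N \<le> \<phi> (s j + e)" by (intro above) simp
        then have "s (j + N) \<le> (s j + e) + 1" by (intro s_le) (simp only: N_shift \<phi>_shift add_le_cancel_right)
        then show "s (j + N) \<le> s j + 1 + e" by simp
      qed
      show "s j + 1 \<le> s (j + N)"
      proof (rule field_le_epsilon)
        fix e :: real assume "e > 0"
        then have "of_int (j + N) / of_int N \<le> \<phi> (s (j + N) + e)" by (intro above) simp
        then have "s j \<le> s (j + N) + e - 1"
          using \<phi>_shift[of "s (j + N) + e - 1"] unfolding N_shift by (intro s_le) simp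
        then show "s j + 1 \<le> s (j + N) + e" by simp
      qed
    qed
    with \<open>mono s\<close> have st: "staircase N s" by (simp add: staircase_def)
    have "F \<le> force (of_int a / of_int N) (of_int i / of_int N) (of_int b / of_int N)"
      if *: "s i \<le> t" "t < s (i + 1)" "s a \<le> t - \<omega>" "t - \<omega> < s (a + 1)" "s b \<le> t + \<omega>" "t + \<omega> < s (b + 1)"
      for t i a b
    proof -
      \<comment> \<open>At t itself the hull function may still be below its level i / N, since the infimum s i need not
        be attained; moving a little to the right avoids this.\<close>
      have "t < min (s (i + 1)) (min (s (a + 1) + \<omega>) (s (b + 1) - \<omega>))" using * by auto
      then obtain r where r: "t < r" "r < min (s (i + 1)) (min (s (a + 1) + \<omega>) (s (b + 1) - \<omega>))"
        using dense by blast
      have near: "\<bar>\<phi> w - of_int k / of_int N\<bar> \<le> \<delta>" if "s k < w" "w < s (k + 1)" for k w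
        using above[OF that(1)] below[OF that(2)] N\<delta> by (simp add: add_divide_distrib)
      have "\<bar>force (\<phi> (r - \<omega>)) (\<phi> r) (\<phi> (r + \<omega>))
        - force (of_int a / of_int N) (of_int i / of_int N) (of_int b / of_int N)\<bar> < F1 - F"
      proof (rule force_modulusD[OF mod])
        show "\<bar>\<phi> (r - \<omega>) - \<phi> r\<bar> \<le> K + 2" "\<bar>\<phi> (r + \<omega>) - \<phi> r\<bar> \<le> K + 2"
          using degree_one_deviation[OF deg, of "r - \<omega>" r] degree_one_deviation[OF deg, of "r + \<omega>" r] \<omega>
          by linarith+
      qed (use * r in \<open>auto intro!: near\<close>)
      moreover have "F1 \<le> force (\<phi> (r - \<omega>)) (\<phi> r) (\<phi> (r + \<omega>))"
        using \<phi> by (simp add: hull_supersolution_def)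
      ultimately show ?thesis by linarith
    qed
    with st show ?thesis unfolding step_admissible_def by blast
  qed
  with N show thesis by (rule that)
qed

lemma step_admissible_transfer:
  assumes s: "step_admissible N F \<omega> s" and s': "staircase N s'" and same: "same_pattern s \<omega> s' \<omega>'"
  shows "step_admissible N F \<omega>' s'"
  unfolding step_admissible_def
proof (intro conjI allI impI s')
  fix t i a b
  assume "s' i \<le> t \<and> t < s' (i + 1) \<and> s' a \<le> t - \<omega>' \<and> t - \<omega>' < s' (a + 1)
    \<and> s' b \<le> t + \<omega>' \<and> t + \<omega>' < s' (b + 1)"
  then have *: "s' i \<le> t" "t < s' (i + 1)" "s' a + \<omega>' \<le> t" "t < s' (a + 1) + \<omega>'"
    "s' b - \<omega>' \<le> t" "t < s' (b + 1) - \<omega>'" by auto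
  have transfer: "s m + of_int k * \<omega> < s n" if "s' m + of_int k * \<omega>' < s' n" "k \<in> {-2..2}" for m n k
    using same that unfolding same_pattern_def by blast
  have "s i < s (i + 1)" "s i < s (a + 1) + \<omega>" "s i < s (b + 1) - \<omega>"
    using transfer[of i 0 "i + 1"] transfer[of i "-1" "a + 1"] transfer[of i 1 "b + 1"] * by auto
  moreover have "s a + \<omega> < s (i + 1)" "s a + \<omega> < s (a + 1) + \<omega>" "s a + \<omega> < s (b + 1) - \<omega>"
    using transfer[of a 1 "i + 1"] transfer[of a 0 "a + 1"] transfer[of a 2 "b + 1"] * by auto
  moreover have "s b - \<omega> < s (i + 1)" "s b - \<omega> < s (a + 1) + \<omega>" "s b - \<omega> < s (b + 1) - \<omega>"
    using transfer[of b "-1" "i + 1"] transfer[of b "-2" "a + 1"] transfer[of b 0 "b + 1"] * by auto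
  \<comment> \<open>the nine inequalities say that the three intervals of the old step function have a common point\<close>
  moreover define r where "r = max (s i) (max (s a + \<omega>) (s b - \<omega>))"
  ultimately have "s i \<le> r" "r < s (i + 1)" "s a \<le> r - \<omega>" "r - \<omega> < s (a + 1)" "s b \<le> r + \<omega>" "r + \<omega> < s (b + 1)"
    by (auto simp: max_def)
  then show "F \<le> force (of_int a / of_int N) (of_int i / of_int N) (of_int b / of_int N)"
    using s unfolding step_admissible_def by blast
qed

text \<open>
Each pattern realized by an admissible step function of force F contributes one interval, by
convexity of the set of its realizations. In particular, the depinning force cannot oscillate
between below F and above F1 infinitely often within [-K, K].
\<close>

lemma admits_covered_by_intervals:
  assumes F: "0 \<le> F" "F < F1"
  obtains \<I> where "finite \<I>" "\<And>I. I \<in> \<I> \<Longrightarrow> convex I" "\<And>I \<omega>. I \<in> \<I> \<Longrightarrow> \<omega> \<in> I \<Longrightarrow> admits F \<omega>"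
    "\<And>\<omega>. \<bar>\<omega>\<bar> \<le> K \<Longrightarrow> admits F1 \<omega> \<Longrightarrow> \<exists>I\<in>\<I>. \<omega> \<in> I"
proof -
  obtain N where N: "N > 0" and step: "\<And>\<omega>. \<bar>\<omega>\<bar> \<le> K \<Longrightarrow> admits F1 \<omega> \<Longrightarrow> \<exists>s. step_admissible N F \<omega> s"
    using admits_imp_step_admissible[OF F(2), of K] by metis
  define pat where "pat s \<omega> = {(i, j, k) \<in> pattern_indices N K. s i + of_int k * \<omega> < s j}"
    for s :: "int \<Rightarrow> real" and \<omega> :: real
  define I where "I P = {\<omega>. \<bar>\<omega>\<bar> \<le> K \<and> (\<exists>s. step_admissible N F \<omega> s \<and> pat s \<omega> = P)}" for P
  have pat_same: "same_pattern s \<omega> s' \<omega>'"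
    if "pat s \<omega> = pat s' \<omega>'" "step_admissible N F \<omega> s" "step_admissible N F \<omega>' s'" "\<bar>\<omega>\<bar> \<le> K" "\<bar>\<omega>'\<bar> \<le> K"
    for s s' \<omega> \<omega>'
  proof (rule same_pattern_if_on_indices[OF _ _ N that(4,5)])
    show "s i + of_int k * \<omega> < s j \<longleftrightarrow> s' i + of_int k * \<omega>' < s' j"
      if "(i, j, k) \<in> pattern_indices N K" for i j k
      using that \<open>pat s \<omega> = pat s' \<omega>'\<close> unfolding pat_def by blast
  qed (use that in \<open>simp_all add: step_admissible_def\<close>)
  have "convex (I P)" for P
    unfolding convex_alt
  proof (intro ballI allI impI)
    fix \<omega> \<omega>' u :: real
    assume in_I: "\<omega> \<in> I P" "\<omega>' \<in> I P" and u: "0 \<le> u \<and> u \<le> 1"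
    then obtain s s' where s: "step_admissible N F \<omega> s" "pat s \<omega> = P" "\<bar>\<omega>\<bar> \<le> K"
      and s': "step_admissible N F \<omega>' s'" "pat s' \<omega>' = P" "\<bar>\<omega>'\<bar> \<le> K"
      unfolding I_def by blast
    define r where "r j = (1 - u) * s j + u * s' j" for j
    define w where "w = (1 - u) * \<omega> + u * \<omega>'"
    have same: "same_pattern s \<omega> r w"
      unfolding r_def[abs_def] w_def using s s' u by (intro same_pattern_convex pat_same) auto
    have "staircase N r"
      unfolding r_def[abs_def] using s s' u by (intro staircase_convex) (auto simp: step_admissible_def)
    then have "step_admissible N F w r"
      using step_admissible_transfer[OF s(1) _ same] by blast
    moreover have "pat r w = P"
      unfolding s(2)[symmetric] pat_def using same unfolding same_pattern_def pattern_indices_def by blast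
    moreover have "\<bar>w\<bar> \<le> K"
    proof -
      have "w \<in> {-K..K}"
        using convexD_alt[of "{-K..K}" \<omega> \<omega>' u] s(3) s'(3) u by (auto simp: w_def abs_le_iff)
      then show ?thesis by auto
    qed
    ultimately show "(1 - u) *\<^sub>R \<omega> + u *\<^sub>R \<omega>' \<in> I P"
      unfolding I_def w_def by auto
  qed
  moreover have "finite (I ` Pow (pattern_indices N K))"
    by (simp add: finite_pattern_indices)
  moreover have "admits F \<omega>" if "\<omega> \<in> I P" for \<omega> P
    using that step_admissible_imp_admits[OF _ N F(1)] unfolding I_def by blast
  moreover have "\<exists>J\<in>I ` Pow (pattern_indices N K). \<omega> \<in> J" if \<omega>: "\<bar>\<omega>\<bar> \<le> K" "admits F1 \<omega>" for \<omega>
  proof -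
    obtain s where "step_admissible N F \<omega> s" using step[OF \<omega>] by blast
    then have "\<omega> \<in> I (pat s \<omega>)" using \<omega> by (auto simp: I_def)
    moreover have "pat s \<omega> \<in> Pow (pattern_indices N K)" unfolding pat_def by blast
    ultimately show ?thesis by blast
  qed
  ultimately show thesis by (intro that[of "I ` Pow (pattern_indices N K)"]) auto
qed

end

section \<open>One-sided limits\<close>

lemma limit_exists_if_no_oscillation:
  fixes f :: "'a \<Rightarrow> real"
  assumes net: "net \<noteq> bot" and nonneg: "\<And>x. 0 \<le> f x" and upper: "\<forall>\<^sub>F x in net. f x < C"
    and gap: "\<And>F F1. 0 \<le> F \<Longrightarrow> F < F1 \<Longrightarrow> \<exists>\<^sub>F x in net. F1 \<le> f x \<Longrightarrow> \<forall>\<^sub>F x in net. F \<le> f x"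
  shows "\<exists>L. (f \<longlongrightarrow> L) net"
proof -
  define S where "S = {F. \<exists>\<^sub>F x in net. F \<le> f x}"
  have zero: "0 \<in> S"
    unfolding S_def using eventually_frequently[OF net] nonneg by simp
  have "F \<le> C" if "F \<in> S" for F
  proof -
    from upper have "\<forall>\<^sub>F x in net. F \<le> f x \<longrightarrow> F \<le> C" by eventually_elim linarith
    with that have "\<exists>\<^sub>F x in net. F \<le> C"
      unfolding S_def mem_Collect_eq by (rule frequently_rev_mp)
    then show ?thesis by (auto dest: frequently_ex)
  qed
  then have bdd: "bdd_above S" by (intro bdd_aboveI)
  have "(f \<longlongrightarrow> Sup S) net"
  proof (rule order_tendstoI)
    fix a assume a: "a < Sup S"
    show "\<forall>\<^sub>F x in net. a < f x"
    proof (cases "a < 0")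
      case True
      then show ?thesis using nonneg by (intro always_eventually allI) (rule less_le_trans)
    next
      case False
      obtain F1 where F1: "F1 \<in> S" "a < F1" using less_cSup_iff[of S a] a zero bdd by blast
      have "\<forall>\<^sub>F x in net. (a + F1) / 2 \<le> f x"
        using F1 False by (intro gap[of _ F1]) (auto simp: S_def)
      then show ?thesis
      proof eventually_elim
        case (elim x)
        then show ?case using F1(2) by (simp add: field_simps)
      qed
    qed
  next
    fix a assume a: "Sup S < a"
    then have "a \<notin> S" using cSup_upper[OF _ bdd, of a] by auto
    then show "\<forall>\<^sub>F x in net. f x < a" by (simp add: S_def not_frequently not_le)
  qed
  then show ?thesis by blast
qed

lemma convex_frequently_at_right:
  fixes I :: "real set"
  assumes "convex I" "\<exists>\<^sub>F x in at_right r. x \<in> I"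
  shows "\<forall>\<^sub>F x in at_right r. x \<in> I"
proof -
  have near: "\<exists>x\<in>I. r < x \<and> x < b" if "r < b" for b
    using assms(2) that unfolding frequently_def eventually_at_right_field by blast
  obtain b where b: "b \<in> I" "r < b" using near[of "r + 1"] by auto
  have "x \<in> I" if x: "r < x" "x < b" for x
  proof -
    obtain a where "a \<in> I" "a < x" using near[OF x(1)] by blast
    then show ?thesis
      using mem_is_interval_1_I[of I a b x] assms(1) b x by (simp add: is_interval_convex_1)
  qed
  then show ?thesis using b(2) unfolding eventually_at_right_field by blast
qed

lemma convex_frequently_at_left:
  fixes I :: "real set"
  assumes "convex I" "\<exists>\<^sub>F x in at_left r. x \<in> I"
  shows "\<forall>\<^sub>F x in at_left r. x \<in> I"
proof -
  have near: "\<exists>x\<in>I. b < x \<and> x < r" if "b < r" for b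
    using assms(2) that unfolding frequently_def eventually_at_left_field by blast
  obtain b where b: "b \<in> I" "b < r" using near[of "r - 1"] by auto
  have "x \<in> I" if x: "x < r" "b < x" for x
  proof -
    obtain a where "a \<in> I" "x < a" using near[OF x(1)] by blast
    then show ?thesis
      using mem_is_interval_1_I[of I b a x] assms(1) b x by (simp add: is_interval_convex_1)
  qed
  then show ?thesis using b(2) unfolding eventually_at_left_field by blast
qed

context fk_chain
begin

lemma depinning_force_one_sided_limit:
  assumes "net = at_right r \<or> net = at_left r"
  shows "\<exists>L. (depinning_force h \<longlongrightarrow> L) net"
proof (rule limit_exists_if_no_oscillation)
  show "net \<noteq> bot" using assms trivial_limit_at_left_real[of r] trivial_limit_at_right_real[of r] by metis
  have le_nhds: "net \<le> nhds r" using assms by (auto simp: at_within_def)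
  have to_net: "\<forall>\<^sub>F x in net. P x" if "\<forall>\<^sub>F x in nhds r. P x" for P
    using that le_nhds by (simp add: filter_leD)
  show "\<forall>\<^sub>F x in net. depinning_force h x < depinning_force h r + 1"
    by (intro to_net depinning_force_upper_semicontinuous) simp
  show "0 \<le> depinning_force h x" for x by (rule depinning_force_nonneg)
  fix F F1 assume F: "0 \<le> F" "F < F1" and freq: "\<exists>\<^sub>F x in net. F1 \<le> depinning_force h x"
  from admits_covered_by_intervals[OF F, of "\<bar>r\<bar> + 1"] obtain \<I> where \<I>: "finite \<I>"
    "\<And>I. I \<in> \<I> \<Longrightarrow> convex I" "\<And>I \<omega>. I \<in> \<I> \<Longrightarrow> \<omega> \<in> I \<Longrightarrow> admits F \<omega>"
    "\<And>\<omega>. \<bar>\<omega>\<bar> \<le> \<bar>r\<bar> + 1 \<Longrightarrow> admits F1 \<omega> \<Longrightarrow> \<exists>I\<in>\<I>. \<omega> \<in> I" by metis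
  have "\<forall>\<^sub>F x in nhds r. \<bar>x\<bar> \<le> \<bar>r\<bar> + 1"
    unfolding eventually_nhds_metric by (rule exI[of _ 1]) (auto simp: dist_real_def)
  from to_net[OF this] have "\<forall>\<^sub>F x in net. F1 \<le> depinning_force h x \<longrightarrow> (\<exists>I\<in>\<I>. x \<in> I)"
    by eventually_elim (use \<I>(4) F admits_iff in auto)
  with freq have "\<exists>\<^sub>F x in net. \<exists>I\<in>\<I>. x \<in> I" by (rule frequently_rev_mp)
  then obtain I where I: "I \<in> \<I>" "\<exists>\<^sub>F x in net. x \<in> I"
    using frequently_bex_finite[OF \<I>(1)] by blast
  then have "\<forall>\<^sub>F x in net. x \<in> I"
    using assms \<I>(2) convex_frequently_at_right convex_frequently_at_left by blast
  then show "\<forall>\<^sub>F x in net. F \<le> depinning_force h x"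
    by eventually_elim (use \<I>(3)[OF I(1)] F admits_iff in blast)
qed

end

section \<open>Continuity at irrational mean spacings\<close>

text \<open>
On the orbit of a point under the group generated by 1 and \<omega>, the coefficient of \<omega> relative to a
base point chosen in each orbit is well defined since \<omega> is irrational.
\<close>

lemma winding_function_exists:
  fixes \<omega> :: real
  assumes irrational: "\<omega> \<notin> \<rat>"
  obtains \<nu> :: "real \<Rightarrow> int" where "\<And>x k m. \<nu> (x + of_int k * \<omega> + of_int m) = \<nu> x + k"
proof -
  define E where "E x = {r. \<exists>k m. x = r + of_int k * \<omega> + of_int m}" for x :: real
  define rep where "rep x = (SOME r. r \<in> E x)" for x
  have E_shift: "E (x + of_int k * \<omega> + of_int m) = E x" for x k m
  proof -
    have "r \<in> E (x + of_int k * \<omega> + of_int m)" if "r \<in> E x" for r x k m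
    proof -
      obtain k' m' where "x = r + of_int k' * \<omega> + of_int m'" using \<open>r \<in> E x\<close> by (auto simp: E_def)
      then have "x + of_int k * \<omega> + of_int m = r + of_int (k' + k) * \<omega> + of_int (m' + m)"
        by (simp add: algebra_simps)
      then show ?thesis unfolding E_def by blast
    qed
    from this[of _ x k m] this[of _ "x + of_int k * \<omega> + of_int m" "- k" "- m"] show ?thesis by auto
  qed
  have "x \<in> E x" for x
    unfolding E_def by (auto intro!: exI[of _ 0])
  then have rep: "rep x \<in> E x" for x unfolding rep_def by (rule someI)
  then obtain \<nu> \<mu> where \<nu>: "\<And>x. x = rep x + of_int (\<nu> x) * \<omega> + of_int (\<mu> x)"
    unfolding E_def mem_Collect_eq by metis
  have "\<nu> (x + of_int k * \<omega> + of_int m) = \<nu> x + k" for x k m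
  proof (rule ccontr)
    let ?y = "x + of_int k * \<omega> + of_int m"
    assume ne: "\<nu> ?y \<noteq> \<nu> x + k"
    have "rep ?y = rep x" by (simp add: rep_def E_shift)
    then have "of_int (\<nu> ?y - \<nu> x - k) * \<omega> = of_int (\<mu> x + m - \<mu> ?y)"
      using \<nu>[of x] \<nu>[of ?y] by (simp add: algebra_simps)
    then have "\<omega> = of_int (\<mu> x + m - \<mu> ?y) / of_int (\<nu> ?y - \<nu> x - k)"
      using ne by (simp add: eq_divide_eq mult.commute)
    also have "\<dots> \<in> \<rat>" by simp
    finally show False using irrational by contradiction
  qed
  then show thesis by (rule that)
qed

context fk_chain
begin

text \<open>
When \<omega> moves to w, the jump s j moves with velocity \<nu> (s j), its winding number. Then all equalities
s i + k * \<omega> = s j are preserved exactly, while the finitely many relevant strict inequalities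
survive for w near \<omega>. So the pattern does not change, and step functions of the new mean
spacing are admissible. At rational \<omega> equalities such as s j + q * \<omega> = s j + p would obstruct
such a motion.
\<close>

lemma step_admissible_near_irrational:
  assumes s: "step_admissible N F \<omega> s" and N: "N > 0" and irrational: "\<omega> \<notin> \<rat>"
  shows "\<forall>\<^sub>F w in nhds \<omega>. \<exists>s'. step_admissible N F w s'"
proof -
  have st: "staircase N s" using s by (simp add: step_admissible_def)
  obtain \<nu> :: "real \<Rightarrow> int" where \<nu>: "\<And>x k m. \<nu> (x + of_int k * \<omega> + of_int m) = \<nu> x + k"
    using winding_function_exists[OF irrational] by blast
  define s' where "s' w j = s j + of_int (\<nu> (s j)) * (w - \<omega>)" for w j
  have shift: "s' w (j + N) = s' w j + 1" for w j
    using staircase_shift[OF st, of j 1] \<nu>[of "s j" 0 1] by (simp add: s'_def)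
  have sign: "\<forall>\<^sub>F w in nhds \<omega>. s i + of_int k * \<omega> < s j \<longleftrightarrow> s' w i + of_int k * w < s' w j" for i j k
  proof -
    have lim: "((\<lambda>w. s' w j - (s' w i + of_int k * w)) \<longlongrightarrow> s j - (s i + of_int k * \<omega>)) (nhds \<omega>)"
    proof -
      have "((\<lambda>w. s' w j - (s' w i + of_int k * w)) \<longlongrightarrow> s' \<omega> j - (s' \<omega> i + of_int k * \<omega>)) (nhds \<omega>)"
        unfolding s'_def by (intro tendsto_intros filterlim_ident)
      then show ?thesis by (simp add: s'_def)
    qed
    consider "s j = s i + of_int k * \<omega>" | "s i + of_int k * \<omega> < s j" | "s j < s i + of_int k * \<omega>"
      by linarith
    then show ?thesis
    proof cases
      case 1
      then have "\<nu> (s j) = \<nu> (s i) + k" using \<nu>[of "s i" k 0] by simp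
      then have "s' w j = s' w i + of_int k * w" for w
        using 1 by (simp add: s'_def algebra_simps)
      then show ?thesis using 1 by simp
    next
      case 2
      then have "\<forall>\<^sub>F w in nhds \<omega>. 0 < s' w j - (s' w i + of_int k * w)"
        by (intro order_tendstoD(1)[OF lim]) simp
      then show ?thesis by eventually_elim (use 2 in simp)
    next
      case 3
      then have "\<forall>\<^sub>F w in nhds \<omega>. s' w j - (s' w i + of_int k * w) < 0"
        by (intro order_tendstoD(2)[OF lim]) simp
      then show ?thesis by eventually_elim (use 3 in simp)
    qed
  qed
  define K where "K = \<bar>\<omega>\<bar> + 1"
  have "\<forall>\<^sub>F w in nhds \<omega>. \<forall>(i, j, k)\<in>pattern_indices N K.
      s i + of_int k * \<omega> < s j \<longleftrightarrow> s' w i + of_int k * w < s' w j"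
    using sign by (intro eventually_ball_finite finite_pattern_indices) auto
  \<comment> \<open>the instances k = 0 that make the moved jumps monotone again\<close>
  moreover have "\<forall>\<^sub>F w in nhds \<omega>. \<forall>j\<in>{0..<N}.
      s (j + 1) + of_int 0 * \<omega> < s j \<longleftrightarrow> s' w (j + 1) + of_int 0 * w < s' w j"
    by (intro eventually_ball_finite ballI sign finite_atLeastLessThan_int)
  moreover have "\<forall>\<^sub>F w in nhds \<omega>. \<bar>w\<bar> \<le> K"
    unfolding eventually_nhds_metric K_def by (rule exI[of _ 1]) (auto simp: dist_real_def)
  ultimately show ?thesis
  proof eventually_elim
    case (elim w)
    have "mono s" using st by (simp add: staircase_def)
    have "s' w j \<le> s' w (j + 1)" if "j \<in> {0..<N}" for j
      using elim(2) that monoD[OF \<open>mono s\<close>, of j "j + 1"] by (auto simp: not_less[symmetric])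
    then have st': "staircase N (s' w)" by (intro staircaseI shift N)
    have "same_pattern s \<omega> (s' w) w"
      using elim(1,3) by (intro same_pattern_if_on_indices[OF st st' N, of _ K]) (auto simp: K_def)
    from step_admissible_transfer[OF s st' this] show ?case by blast
  qed
qed

lemma depinning_force_continuous_at_irrational:
  assumes "\<omega> \<notin> \<rat>"
  shows "isCont (depinning_force h) \<omega>"
  unfolding isCont_def tendsto_at_iff_tendsto_nhds
proof (rule order_tendstoI)
  fix a assume a: "a < depinning_force h \<omega>"
  show "\<forall>\<^sub>F w in nhds \<omega>. a < depinning_force h w"
  proof (cases "a < 0")
    case True
    then show ?thesis
      by (intro always_eventually allI) (rule less_le_trans[OF _ depinning_force_nonneg])
  next
    case False
    define F where "F = (a + depinning_force h \<omega>) / 2"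
    have F: "a < F" "F < depinning_force h \<omega>" "0 \<le> F" using a False by (auto simp: F_def)
    obtain N where N: "N > 0"
      and step: "\<And>w. \<bar>w\<bar> \<le> \<bar>\<omega>\<bar> \<Longrightarrow> admits (depinning_force h \<omega>) w \<Longrightarrow> \<exists>s. step_admissible N F w s"
      using admits_imp_step_admissible[OF F(2), of "\<bar>\<omega>\<bar>"] by metis
    have "admits (depinning_force h \<omega>) \<omega>" by (simp add: admits_iff depinning_force_nonneg)
    then obtain s where "step_admissible N F \<omega> s" using step[of \<omega>] by auto
    from step_admissible_near_irrational[OF this N assms] show ?thesis
    proof eventually_elim
      case (elim w)
      then have "admits F w" using step_admissible_imp_admits[OF _ N F(3)] by blast
      then show ?case using F by (simp add: admits_iff)
    qed
  qed
qed (rule depinning_force_upper_semicontinuous)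

section \<open>Continuity on the space of rotation symbols\<close>

text \<open>
The values at the symbols r+ and r- are limits of values at real numbers, so closed conditions on
the latter extend to them.
\<close>

lemma depinning_force_rot_in_closed:
  assumes C: "closed C" and in_C: "\<And>w. a < w \<Longrightarrow> w < b \<Longrightarrow> depinning_force h w \<in> C"
    and \<tau>: "a < underlying \<tau>" "underlying \<tau> < b"
  shows "depinning_force_rot h \<tau> \<in> C"
proof -
  have "Lim net (depinning_force h) \<in> C"
    if net: "net = at_right r \<or> net = at_left r" and r: "a < r" "r < b" for net r
  proof -
    have ne: "net \<noteq> bot"
      using net trivial_limit_at_left_real[of r] trivial_limit_at_right_real[of r] by metis
    obtain L where L: "(depinning_force h \<longlongrightarrow> L) net"
      using depinning_force_one_sided_limit[OF net] by blast
    have "\<forall>\<^sub>F w in nhds r. a < w" "\<forall>\<^sub>F w in nhds r. w < b"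
      using r by (auto intro: eventually_nhds_in_open[of "{a<..}", simplified]
          eventually_nhds_in_open[of "{..<b}", simplified])
    then have "\<forall>\<^sub>F w in nhds r. depinning_force h w \<in> C"
      by eventually_elim (rule in_C)
    moreover have "net \<le> nhds r" using net by (auto simp: at_within_def)
    ultimately have "\<forall>\<^sub>F w in net. depinning_force h w \<in> C" by (simp add: filter_leD)
    then have "L \<in> C" using Lim_in_closed_set[OF C _ ne L] by blast
    then show ?thesis using tendsto_Lim[OF ne L] by simp
  qed
  then show ?thesis using \<tau> in_C by (cases \<tau>) auto
qed

text \<open>
The symbol of a rational number is isolated, and r+ has a neighbourhood basis of intervals starting
at r+ itself; so only the existence of one-sided limits and the continuity at irrational numbers
enter.
\<close>

lemma depinning_force_rot_isCont: "isCont (depinning_force_rot h) \<sigma>"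
  unfolding isCont_def
proof (rule tendstoI)
  let ?f = "depinning_force h" and ?g = "depinning_force_rot h"
  fix e :: real assume e: "e > 0"
  have nbhd: "\<forall>\<^sub>F \<tau> in at \<sigma>. dist (?g \<tau>) (?g \<sigma>) < e"
    if U: "open U" "\<sigma> \<in> U" and close: "\<And>w. a < w \<Longrightarrow> w < b \<Longrightarrow> dist (?f w) (?g \<sigma>) < e / 2"
      and U_sub: "\<And>\<tau>. \<tau> \<in> U \<Longrightarrow> \<tau> \<noteq> \<sigma> \<Longrightarrow> a < underlying \<tau> \<and> underlying \<tau> < b"
    for U a b
  proof -
    have "dist (?g \<tau>) (?g \<sigma>) < e" if "\<tau> \<in> U" "\<tau> \<noteq> \<sigma>" for \<tau>
    proof -
      have "?g \<tau> \<in> cball (?g \<sigma>) (e / 2)"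
        using U_sub[OF that] close
        by (intro depinning_force_rot_in_closed[of _ a b]) (auto simp: dist_commute less_imp_le)
      then show ?thesis using e by (simp add: dist_commute)
    qed
    then show ?thesis unfolding eventually_at_topological using U by blast
  qed
  have e2: "e / 2 > 0" using e by simp
  show "\<forall>\<^sub>F \<tau> in at \<sigma>. dist (?g \<tau>) (?g \<sigma>) < e"
  proof (cases \<sigma>)
    case (Number w)
    show ?thesis
    proof (cases "w \<in> \<rat>")
      case True
      then obtain r where r: "w = of_rat r" by (auto elim: Rats_cases)
      have "\<tau> = \<sigma>" if "\<tau> \<in> {Minus r<..<Plus r}" for \<tau>
        using that Number r by (cases \<tau>) (auto simp: less_rotsym_def)
      moreover have "\<sigma> \<in> {Minus r<..<Plus r}" using Number r by (simp add: less_rotsym_def)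
      ultimately show ?thesis
        unfolding eventually_at_topological
        using open_greaterThanLessThan[of "Minus r" "Plus r"] by metis
    next
      case False
      then have "isCont ?f w" by (rule depinning_force_continuous_at_irrational)
      then obtain d where d: "d > 0" "\<And>x. dist x w < d \<Longrightarrow> dist (?f x) (?f w) < e / 2"
        using tendstoD[of ?f "?f w" "nhds w", OF _ e2]
        unfolding isCont_def tendsto_at_iff_tendsto_nhds eventually_nhds_metric by blast
      show ?thesis
      proof (rule nbhd[of "{Number (w - d / 2)<..<Number (w + d / 2)}" "w - d" "w + d"])
        show "\<sigma> \<in> {Number (w - d / 2)<..<Number (w + d / 2)}"
          using d(1) Number by (simp add: less_rotsym_def)
        show "dist (?f x) (?g \<sigma>) < e / 2" if "w - d < x" "x < w + d" for x
          using that d(2)[of x] Number by (auto simp: dist_real_def abs_less_iff)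
        show "w - d < underlying \<tau> \<and> underlying \<tau> < w + d"
          if "\<tau> \<in> {Number (w - d / 2)<..<Number (w + d / 2)}" for \<tau>
          using that d(1) by (auto simp: less_rotsym_def)
      qed simp
    qed
  next
    case (Plus r)
    let ?r = "of_rat r :: real"
    obtain L where L: "(?f \<longlongrightarrow> L) (at_right ?r)"
      using depinning_force_one_sided_limit by blast
    have g: "?g \<sigma> = L"
      using tendsto_Lim[OF trivial_limit_at_right_real L] Plus by simp
    from tendstoD[OF L e2] obtain b where b: "?r < b" "\<And>w. ?r < w \<Longrightarrow> w < b \<Longrightarrow> dist (?f w) L < e / 2"
      unfolding eventually_at_right_field by blast
    define m where "m = (?r + b) / 2"
    have m: "?r < m" "m < b" using b(1) by (auto simp: m_def)
    show ?thesis
    proof (rule nbhd[of "{Number ?r<..<Number m}" ?r b])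
      show "\<sigma> \<in> {Number ?r<..<Number m}" using m Plus by (simp add: less_rotsym_def)
      show "?r < underlying \<tau> \<and> underlying \<tau> < b" if "\<tau> \<in> {Number ?r<..<Number m}" "\<tau> \<noteq> \<sigma>" for \<tau>
        using that m Plus by (cases \<tau>) (auto simp: less_rotsym_def)
    qed (use b(2) g in auto)
  next
    case (Minus r)
    let ?r = "of_rat r :: real"
    obtain L where L: "(?f \<longlongrightarrow> L) (at_left ?r)"
      using depinning_force_one_sided_limit by blast
    have g: "?g \<sigma> = L"
      using tendsto_Lim[OF trivial_limit_at_left_real L] Minus by simp
    from tendstoD[OF L e2] obtain b where b: "b < ?r" "\<And>w. b < w \<Longrightarrow> w < ?r \<Longrightarrow> dist (?f w) L < e / 2"
      unfolding eventually_at_left_field by blast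
    define m where "m = (b + ?r) / 2"
    have m: "b < m" "m < ?r" using b(1) by (auto simp: m_def)
    show ?thesis
    proof (rule nbhd[of "{Number m<..<Number ?r}" b ?r])
      show "\<sigma> \<in> {Number m<..<Number ?r}" using m Minus by (simp add: less_rotsym_def)
      show "b < underlying \<tau> \<and> underlying \<tau> < ?r" if "\<tau> \<in> {Number m<..<Number ?r}" "\<tau> \<noteq> \<sigma>" for \<tau>
        using that m Minus by (cases \<tau>) (auto simp: less_rotsym_def)
    qed (use b(2) g in auto)
  qed
qed

end

theorem corollary1:
  fixes h :: "real \<Rightarrow> real \<Rightarrow> real" and c :: real
  assumes "C2_fun h"
    and "\<And>x x'. h (x + 1) (x' + 1) = h x x'"
    and "c > 0"
    and "\<And>x x'. D2 (D1 h) x x' \<le> - c"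
  shows "continuous_on UNIV (depinning_force_rot h)"
proof -
  interpret fk_chain h c using assms by unfold_locales
  show ?thesis
    using depinning_force_rot_isCont by (simp add: continuous_on_eq_continuous_at)
qed

end
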